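(* There is a nonempty set $A_0$ contained in the unit cube in $\mathbb{R}^2$ which is $1$-Ahlfors regular and countably $1$-rectifiable and such that, with $\mu = \mathcal{H}^1 \llcorner A_0$, for every $x \in A_0$ and every $\delta > 0$, $$\int_{B_\delta(x)} \int_0^\delta \beta_{A_0;2}^1(y,r)^2 \, \frac{dr}{r} \, d\mu(y) = \infty .$$
   Context: $\mathcal{H}^1$ is one-dimensional Hausdorff measure on $\mathbb{R}^2$ (normalized so that a unit segment has measure $1$), $\mathcal{H}^1 \llcorner E$ is its restriction to $E$, and $B_r(x) = B(x,r)$ is the ball of center $x$ and radius $r$. The unit cube is $[0,1]^2$. A set $E \subset \mathbb{R}^2$ is $1$-Ahlfors regular if there exist $0 < c < C < \infty$ such that $c r \le \mathcal{H}^1(E \cap B(x,r)) \le C r$ for all $x \in E$ and all $0 < r < \operatorname{diam}(E)$. A set $E \subset \mathbb{R}^2$ is countably $1$-rectifiable if there are Lipschitz maps $f_i : \mathbb{R} \to \mathbb{R}^2$, $i = 1,2,\dots$, with $\mathcal{H}^1\left(E \setminus \bigcup_i f_i(\mathbb{R})\right) = 0$. For $E \subset \mathbb{R}^2$ and $\mu = \mathcal{H}^1 \llcorner E$, the Jones $\beta$-number is $$\beta_{E;2}^1(x,r) = \left( \inf_{L} \int_{B(x,r)} \left( \frac{\operatorname{dist}(y,L)}{r} \right)^2 \frac{d\mu(y)}{r} \right)^{1/2},$$ where the infimum is over all (affine) lines $L \subset \mathbb{R}^2$. *)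

theory Defs
  imports "HOL-Analysis.Analysis"
begin

section \<open>One-dimensional Hausdorff measure\<close>

text \<open>
  The extended-real diameter. The library's \<open>diameter\<close> is real-valued and unspecified on
  unbounded sets. Here the empty set has diameter 0 and unbounded sets have diameter \<open>\<infinity>\<close>.
\<close>

definition ediam :: "'a::metric_space set \<Rightarrow> ennreal" where
  "ediam S = (SUP x\<in>S. SUP y\<in>S. ennreal (dist x y))"

text \<open>
  Summing the plain diameters, with no further constant, is the normalization giving a unit
  segment measure 1. Finite covers are included, padded with empty sets.
\<close>

definition hausdorff1_pre :: "real \<Rightarrow> 'a::metric_space set \<Rightarrow> ennreal" where
  "hausdorff1_pre \<delta> A =
     (INF U\<in>{U :: nat \<Rightarrow> 'a set. A \<subseteq> (\<Union>i. U i) \<and> (\<forall>i. ediam (U i) \<le> ennreal \<delta>)}.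
        \<Sum>i. ediam (U i))"

definition hausdorff1 :: "'a::metric_space set \<Rightarrow> ennreal" where
  "hausdorff1 A = (SUP \<delta>\<in>{0<..}. hausdorff1_pre \<delta> A)"

text \<open>
  The restriction to \<open>E\<close>, as a Borel measure on the whole space. No measurability of \<open>E\<close> is
  needed; \<open>emeasure_hausdorff1_restr\<close> below shows that \<open>measure_of\<close> does not take its default
  value here.
\<close>

definition hausdorff1_restr :: "'a::metric_space set \<Rightarrow> 'a measure" where
  "hausdorff1_restr E = measure_of UNIV (sets borel) (\<lambda>B. hausdorff1 (E \<inter> B))"

lemma dist_le_ediam: "x \<in> S \<Longrightarrow> y \<in> S \<Longrightarrow> ennreal (dist x y) \<le> ediam S"
  unfolding ediam_def by (meson SUP_upper2 SUP_upper)

lemma ediam_empty [simp]: "ediam {} = 0"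
  by (simp add: ediam_def bot_ennreal)

lemma hausdorff1_pre_le:
  "A \<subseteq> (\<Union>i. U i) \<Longrightarrow> (\<And>i. ediam (U i) \<le> ennreal \<delta>) \<Longrightarrow> hausdorff1_pre \<delta> A \<le> (\<Sum>i. ediam (U i))"
  unfolding hausdorff1_pre_def by (rule INF_lower) auto

lemma hausdorff1_pre_antimono: "\<delta> \<le> \<delta>' \<Longrightarrow> hausdorff1_pre \<delta>' A \<le> hausdorff1_pre \<delta> A"
  unfolding hausdorff1_pre_def
  by (rule INF_superset_mono) (auto intro: order_trans[OF _ ennreal_leI])

lemma hausdorff1_pre_mono: "A \<subseteq> B \<Longrightarrow> hausdorff1_pre \<delta> A \<le> hausdorff1_pre \<delta> B"
  unfolding hausdorff1_pre_def by (rule INF_superset_mono) auto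

lemma hausdorff1_pre_le_hausdorff1: "0 < \<delta> \<Longrightarrow> hausdorff1_pre \<delta> A \<le> hausdorff1 A"
  unfolding hausdorff1_def by (rule SUP_upper) auto

lemma hausdorff1_mono: "A \<subseteq> B \<Longrightarrow> hausdorff1 A \<le> hausdorff1 B"
  unfolding hausdorff1_def by (rule SUP_mono) (blast intro: hausdorff1_pre_mono)

lemma hausdorff1_empty [simp]: "hausdorff1 {} = 0"
proof -
  have "hausdorff1_pre \<delta> ({}::'a set) = 0" for \<delta>
    using hausdorff1_pre_le[of "{}" "\<lambda>_. {}::'a set" \<delta>] by simp
  then show ?thesis by (simp add: hausdorff1_def)
qed

lemma hausdorff1_pre_close:
  "hausdorff1_pre \<delta> A < e \<Longrightarrow>
    \<exists>U. A \<subseteq> (\<Union>i. U i) \<and> (\<forall>i. ediam (U i) \<le> ennreal \<delta>) \<and> (\<Sum>i. ediam (U i)) < e"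
  unfolding hausdorff1_pre_def INF_less_iff by auto

lemma hausdorff1_pre_UN_le: "hausdorff1_pre \<delta> (\<Union>i. A i) \<le> (\<Sum>i. hausdorff1_pre \<delta> (A i))"
  for A :: "nat \<Rightarrow> 'a::metric_space set"
proof (rule ennreal_le_epsilon)
  fix e :: real assume e: "0 < e" "(\<Sum>i. hausdorff1_pre \<delta> (A i)) < top"
  then have "hausdorff1_pre \<delta> (A n) < hausdorff1_pre \<delta> (A n) + ennreal (e * (1/2) ^ Suc n)" for n
    by (auto simp add: less_top dest!: ennreal_suminf_lessD)
  then have "\<exists>U. A n \<subseteq> (\<Union>i. U i) \<and> (\<forall>i. ediam (U i) \<le> ennreal \<delta>) \<and>
      (\<Sum>i. ediam (U i)) < hausdorff1_pre \<delta> (A n) + ennreal (e * (1/2) ^ Suc n)" for n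
    by (rule hausdorff1_pre_close)
  then obtain U where U: "\<And>n. A n \<subseteq> (\<Union>i. U n i)" "\<And>n i. ediam (U n i) \<le> ennreal \<delta>"
      "\<And>n. (\<Sum>i. ediam (U n i)) < hausdorff1_pre \<delta> (A n) + ennreal (e * (1/2) ^ Suc n)"
    by metis
  define C where "C = case_prod U o prod_decode"
  have "(\<Union>i. A i) \<subseteq> (\<Union>i. C i)"
    using U(1) by (auto simp add: C_def subset_eq) (metis prod.case prod_encode_inverse)
  then have "hausdorff1_pre \<delta> (\<Union>i. A i) \<le> (\<Sum>i. ediam (C i))"
    using U(2) by (intro hausdorff1_pre_le) (auto simp: C_def split: prod.split)
  also have "\<dots> = (\<Sum>n. \<Sum>i. ediam (U n i))"
    unfolding C_def comp_def by (intro suminf_ennreal_2dimen) auto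
  also have "\<dots> \<le> (\<Sum>n. hausdorff1_pre \<delta> (A n) + ennreal (e * (1/2) ^ Suc n))"
    using U(3) by (intro suminf_le) (auto intro: less_imp_le)
  also have "\<dots> = (\<Sum>n. hausdorff1_pre \<delta> (A n)) + (\<Sum>n. ennreal e * ennreal ((1/2) ^ Suc n))"
    using e by (subst suminf_add[symmetric])
      (auto simp del: ennreal_suminf_cmult simp add: ennreal_mult[symmetric])
  also have "\<dots> = (\<Sum>n. hausdorff1_pre \<delta> (A n)) + e"
    unfolding ennreal_suminf_cmult
    by (subst suminf_ennreal_eq[OF zero_le_power power_half_series]) auto
  finally show "hausdorff1_pre \<delta> (\<Union>i. A i) \<le> (\<Sum>n. hausdorff1_pre \<delta> (A n)) + e" .
qed

lemma hausdorff1_UN_le: "hausdorff1 (\<Union>i. A i) \<le> (\<Sum>i. hausdorff1 (A i))"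
  for A :: "nat \<Rightarrow> 'a::metric_space set"
  unfolding hausdorff1_def[of "\<Union>i. A i"]
  by (rule SUP_least)
     (auto intro!: order_trans[OF hausdorff1_pre_UN_le] suminf_le hausdorff1_pre_le_hausdorff1)

lemma outer_measure_space_hausdorff1: "outer_measure_space UNIV hausdorff1"
  by (auto simp: outer_measure_space_def positive_def increasing_def countably_subadditive_def
      hausdorff1_mono hausdorff1_UN_le)

lemma hausdorff1_Un_le: "hausdorff1 (A \<union> B) \<le> hausdorff1 A + hausdorff1 B"
  using hausdorff1_UN_le[of "binaryset A B"] suminf_binaryset_eq[of hausdorff1 A B]
  by (simp add: UN_binaryset_eq)

lemma hausdorff1_add_separated:
  assumes d: "0 < d" and sep: "\<And>x y. x \<in> X \<Longrightarrow> y \<in> Y \<Longrightarrow> d \<le> dist x y"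
  shows "hausdorff1 X + hausdorff1 Y \<le> hausdorff1 (X \<union> Y)"
proof -
  have *: "hausdorff1_pre a X + hausdorff1_pre b Y \<le> hausdorff1 (X \<union> Y)" if "0 < a" "0 < b" for a b
  proof -
    define c where "c = min (min a b) (d/2)"
    have c: "0 < c" "c \<le> a" "c \<le> b" "c < d" using that d by (auto simp: c_def)
    have "hausdorff1_pre c X + hausdorff1_pre c Y \<le> (\<Sum>i. ediam (U i))"
      if U: "X \<union> Y \<subseteq> (\<Union>i. U i)" "\<And>i. ediam (U i) \<le> ennreal c" for U :: "nat \<Rightarrow> 'a set"
    proof -
      define V where "V i = (if U i \<inter> X = {} then {} else U i)" for i
      define W where "W i = (if U i \<inter> Y = {} then {} else U i)" for i
      have disj: "U i \<inter> X = {} \<or> U i \<inter> Y = {}" for i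
      proof (rule ccontr)
        assume "\<not> ?thesis"
        then obtain x y where xy: "x \<in> U i" "x \<in> X" "y \<in> U i" "y \<in> Y" by auto
        then have "ennreal (dist x y) \<le> ennreal c" using dist_le_ediam U(2) order_trans by blast
        then have "dist x y \<le> c" using c by (simp add: ennreal_le_iff)
        then show False using sep[of x y] xy c by simp
      qed
      have "hausdorff1_pre c X \<le> (\<Sum>i. ediam (V i))"
        using U by (intro hausdorff1_pre_le) (fastforce simp: V_def)+
      moreover have "hausdorff1_pre c Y \<le> (\<Sum>i. ediam (W i))"
        using U by (intro hausdorff1_pre_le) (fastforce simp: W_def)+
      ultimately have "hausdorff1_pre c X + hausdorff1_pre c Y \<le> (\<Sum>i. ediam (V i)) + (\<Sum>i. ediam (W i))"
        by (rule add_mono)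
      also have "\<dots> = (\<Sum>i. ediam (V i) + ediam (W i))" by (rule suminf_add) auto
      also have "\<dots> \<le> (\<Sum>i. ediam (U i))"
        using disj by (intro suminf_le) (auto simp: V_def W_def)
      finally show ?thesis .
    qed
    then have "hausdorff1_pre c X + hausdorff1_pre c Y \<le> hausdorff1_pre c (X \<union> Y)"
      unfolding hausdorff1_pre_def[of c "X \<union> Y"] by (intro INF_greatest) auto
    also have "\<dots> \<le> hausdorff1 (X \<union> Y)" using c by (intro hausdorff1_pre_le_hausdorff1)
    finally show ?thesis
      using c by (meson add_mono hausdorff1_pre_antimono order_trans)
  qed
  have "hausdorff1_pre a X + hausdorff1 Y \<le> hausdorff1 (X \<union> Y)" if "0 < a" for a
    unfolding hausdorff1_def[of Y] using *[OF that]
    by (subst ennreal_SUP_add_right) (auto intro!: SUP_least)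
  then show ?thesis
    unfolding hausdorff1_def[of X]
    by (subst ennreal_SUP_add_left[symmetric]) (auto intro!: SUP_least)
qed

lemma closed_hausdorff1_additive:
  fixes X F :: "'a::metric_space set"
  assumes F: "closed F" "F \<noteq> {}"
  shows "hausdorff1 (X \<inter> F) + hausdorff1 (X - F) \<le> hausdorff1 X"
proof (cases "hausdorff1 X = \<infinity>")
  case False
  define Xn where "Xn n = {x \<in> X. infdist x F \<ge> 1 / real (Suc n)}" for n
  define R where "R n = Xn (Suc n) - Xn n" for n
  have sepF: "hausdorff1 (X \<inter> F) + hausdorff1 (Xn n) \<le> hausdorff1 X" for n
  proof -
    have "hausdorff1 (X \<inter> F) + hausdorff1 (Xn n) \<le> hausdorff1 ((X \<inter> F) \<union> Xn n)"
    proof (rule hausdorff1_add_separated[of "1 / real (Suc n)"])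
      fix x y assume "x \<in> X \<inter> F" "y \<in> Xn n"
      then show "1 / real (Suc n) \<le> dist x y"
        using infdist_le[of x F y] by (auto simp: Xn_def dist_commute)
    qed simp
    also have "\<dots> \<le> hausdorff1 X" by (rule hausdorff1_mono) (auto simp: Xn_def)
    finally show ?thesis .
  qed
  have Rsep: "1 / real (n+2) - 1 / real (n+3) \<le> dist x y"
    if "x \<in> R k" "y \<in> R j" "k \<le> n" "n + 2 \<le> j" for x y k j n
  proof -
    have "1 / real (n+2) \<le> 1 / real (k+2)" using that by (simp add: frac_le)
    also have "\<dots> \<le> infdist x F" using that by (simp add: R_def Xn_def add.commute)
    finally have 1: "1 / real (n+2) \<le> infdist x F" .
    have "infdist y F < 1 / real (j+1)" using that by (auto simp: R_def Xn_def not_le add.commute)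
    also have "\<dots> \<le> 1 / real (n+3)" using that by (simp add: frac_le)
    finally have "infdist y F < 1 / real (n+3)" .
    moreover have "infdist x F \<le> infdist y F + dist x y" by (rule infdist_triangle)
    ultimately show ?thesis using 1 by linarith
  qed
  have fin: "(\<Sum>k<n. hausdorff1 (R (2*k+c))) \<le> hausdorff1 (\<Union>k<n. R (2*k+c))" for n c
  proof (induction n)
    case (Suc n)
    have "(\<Sum>k<Suc n. hausdorff1 (R (2*k+c))) \<le> hausdorff1 (\<Union>k<n. R (2*k+c)) + hausdorff1 (R (2*n+c))"
      using Suc by (simp add: add_right_mono)
    also have "\<dots> \<le> hausdorff1 ((\<Union>k<n. R (2*k+c)) \<union> R (2*n+c))"
    proof (cases n)
      case (Suc m)
      show ?thesis
      proof (rule hausdorff1_add_separated)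
        show "0 < 1 / real (2*m+c+2) - 1 / real (2*m+c+3)" by (simp add: frac_less2)
        fix x y assume "x \<in> (\<Union>k<n. R (2*k+c))" "y \<in> R (2*n+c)"
        then obtain k where "k < n" "x \<in> R (2*k+c)" "y \<in> R (2*n+c)" by blast
        then show "1 / real (2*m+c+2) - 1 / real (2*m+c+3) \<le> dist x y"
          using Suc by (intro Rsep[of x "2*k+c" y "2*n+c"]) auto
      qed
    qed simp
    also have "(\<Union>k<n. R (2*k+c)) \<union> R (2*n+c) = (\<Union>k<Suc n. R (2*k+c))"
      by (auto simp: less_Suc_eq)
    finally show ?case .
  qed simp
  have bound: "(\<Sum>k. hausdorff1 (R (2*k+c))) \<le> hausdorff1 X" for c
  proof (rule suminf_le_const[OF summableI])
    show "(\<Sum>k<n. hausdorff1 (R (2*k+c))) \<le> hausdorff1 X" for n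
      by (rule order_trans[OF fin hausdorff1_mono]) (auto simp: R_def Xn_def)
  qed
  have sum_fin: "(\<Sum>k. hausdorff1 (R k)) \<le> hausdorff1 X + hausdorff1 X"
  proof (rule suminf_le_const[OF summableI])
    fix n
    have "(\<Sum>k<n. hausdorff1 (R k)) \<le> (\<Sum>k<2*n. hausdorff1 (R k))"
      by (rule sum_mono2) auto
    also have "\<dots> = (\<Sum>k<n. hausdorff1 (R (2*k+0))) + (\<Sum>k<n. hausdorff1 (R (2*k+1)))"
      by (induction n) (auto simp: algebra_simps)
    also have "\<dots> \<le> (\<Sum>k. hausdorff1 (R (2*k+0))) + (\<Sum>k. hausdorff1 (R (2*k+1)))"
      by (intro add_mono sum_le_suminf) auto
    also have "\<dots> \<le> hausdorff1 X + hausdorff1 X" by (intro add_mono bound)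
    finally show "(\<Sum>k<n. hausdorff1 (R k)) \<le> hausdorff1 X + hausdorff1 X" .
  qed
  then have sum_top: "(\<Sum>k. hausdorff1 (R k)) < \<infinity>"
    using False by (simp add: less_top[symmetric] top_unique le_less_trans)
      (metis ennreal_add_eq_top top_unique)
  have cover: "X - F \<subseteq> Xn n \<union> (\<Union>k. R (k+n))" for n
  proof
    fix x assume x: "x \<in> X - F"
    then have "infdist x F > 0"
      using F by (simp add: infdist_pos_not_in_closed)
    then obtain m where "1 / real (Suc m) < infdist x F"
      using nat_approx_posE by blast
    then have "x \<in> Xn m" using x by (simp add: Xn_def)
    then have *: "\<exists>m. x \<in> Xn m" by auto
    define l where "l = (LEAST m. x \<in> Xn m)"
    have l: "x \<in> Xn l" using LeastI_ex[OF *] by (simp add: l_def)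
    show "x \<in> Xn n \<union> (\<Union>k. R (k+n))"
    proof (cases "l \<le> n")
      case True
      then have "1 / real (Suc n) \<le> 1 / real (Suc l)" by (simp add: frac_le)
      then have "x \<in> Xn n" using l by (auto simp: Xn_def)
      then show ?thesis by simp
    next
      case False
      then obtain p where p: "l = Suc p" "n \<le> p" by (metis Suc_le_D not_less_eq_eq not_le le_SucE Suc_le_mono)
      have "x \<notin> Xn p" using p not_less_Least[of p "\<lambda>m. x \<in> Xn m"] by (auto simp: l_def)
      then have "x \<in> R ((p - n) + n)" using l p by (auto simp: R_def)
      then show ?thesis by blast
    qed
  qed
  have le: "hausdorff1 (X \<inter> F) + hausdorff1 (X - F) \<le> hausdorff1 X + (\<Sum>k. hausdorff1 (R (k+n)))" for n
  proof -
    have "hausdorff1 (X - F) \<le> hausdorff1 (Xn n \<union> (\<Union>k. R (k+n)))"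
      using cover by (rule hausdorff1_mono)
    also have "\<dots> \<le> hausdorff1 (Xn n) + (\<Sum>k. hausdorff1 (R (k+n)))"
      by (intro order_trans[OF hausdorff1_Un_le] add_left_mono hausdorff1_UN_le)
    finally have "hausdorff1 (X \<inter> F) + hausdorff1 (X - F)
        \<le> (hausdorff1 (X \<inter> F) + hausdorff1 (Xn n)) + (\<Sum>k. hausdorff1 (R (k+n)))"
      by (simp add: add.assoc add_left_mono)
    also have "\<dots> \<le> hausdorff1 X + (\<Sum>k. hausdorff1 (R (k+n)))"
      by (intro add_right_mono sepF)
    finally show ?thesis .
  qed
  show ?thesis
  proof (rule ennreal_le_epsilon)
    fix e :: real assume e: "0 < e"
    have Rn: "hausdorff1 (R k) \<noteq> \<infinity>" for k
      using sum_top ennreal_suminf_lessD[of "\<lambda>k. hausdorff1 (R k)" \<infinity> k] by auto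
    define g where "g k = enn2real (hausdorff1 (R k))" for k
    have g: "hausdorff1 (R k) = ennreal (g k)" "0 \<le> g k" for k
      using Rn by (auto simp: g_def less_top)
    have sg: "summable g"
      using sum_top g by (intro summable_suminf_not_top) auto
    obtain n where n: "norm (\<Sum>k. g (k+n)) < e"
      using suminf_exist_split[OF e sg] by blast
    have "(\<Sum>k. hausdorff1 (R (k+n))) = ennreal (\<Sum>k. g (k+n))"
      using g sg by (simp add: suminf_ennreal2 summable_ignore_initial_segment)
    also have "\<dots> \<le> ennreal e" using n by (intro ennreal_leI) auto
    finally show "hausdorff1 (X \<inter> F) + hausdorff1 (X - F) \<le> hausdorff1 X + ennreal e"
      using le[of n] by (meson add_left_mono order_trans)
  qed
qed simp

lemma borel_subset_caratheodory_hausdorff1: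
  "sets (borel :: 'a::metric_space measure) \<subseteq> lambda_system UNIV UNIV hausdorff1"
proof -
  interpret sigma_algebra UNIV "UNIV :: 'a set set"
    using sigma_algebra_Pow[of UNIV] by simp
  have ms: "sigma_algebra UNIV (lambda_system UNIV UNIV (hausdorff1 :: 'a set \<Rightarrow> ennreal))"
    using caratheodory_lemma[OF outer_measure_space_hausdorff1] by (simp add: measure_space_def)
  have "Collect closed \<subseteq> lambda_system UNIV UNIV (hausdorff1 :: 'a set \<Rightarrow> ennreal)"
  proof
    fix F :: "'a set" assume "F \<in> Collect closed"
    then have F: "closed F" by simp
    have "hausdorff1 (X \<inter> F) + hausdorff1 (X - F) = hausdorff1 X" for X
    proof (cases "F = {}")
      case False
      have "hausdorff1 X = hausdorff1 ((X \<inter> F) \<union> (X - F))" by (simp add: Un_Diff_Int Un_commute)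
      then have "hausdorff1 X \<le> hausdorff1 (X \<inter> F) + hausdorff1 (X - F)"
        using hausdorff1_Un_le by metis
      then show ?thesis using closed_hausdorff1_additive[OF F False, of X] by simp
    qed simp
    then show "F \<in> lambda_system UNIV UNIV hausdorff1" by (simp add: lambda_system_eq)
  qed
  then show ?thesis
    by (simp add: borel_eq_closed sigma_algebra.sigma_sets_subset[OF ms])
qed

lemma space_hausdorff1_restr [simp]: "space (hausdorff1_restr E) = UNIV"
  and sets_hausdorff1_restr [simp, measurable_cong]: "sets (hausdorff1_restr E) = sets borel"
  unfolding hausdorff1_restr_def
  using sets.sets_measure_of_eq[of borel] by (simp_all add: space_measure_of_conv)

lemma emeasure_hausdorff1_restr:
  fixes E :: "'a::metric_space set"
  assumes B: "B \<in> sets borel"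
  shows "emeasure (hausdorff1_restr E) B = hausdorff1 (E \<inter> B)"
  unfolding hausdorff1_restr_def
proof (rule emeasure_measure_of_sigma)
  have alg: "algebra UNIV (UNIV :: 'a set set)"
    using algebra_Pow[of "UNIV :: 'a set"] by simp
  show "sigma_algebra UNIV (sets (borel :: 'a measure))"
    by (metis sets.sigma_algebra_axioms space_borel)
  show "positive (sets borel) (\<lambda>B. hausdorff1 (E \<inter> B))"
    by (simp add: positive_def)
  show "countably_additive (sets borel) (\<lambda>B. hausdorff1 (E \<inter> B))"
  proof (rule countably_additiveI)
    fix A :: "nat \<Rightarrow> 'a set"
    assume A: "range A \<subseteq> sets borel" "disjoint_family A"
    have A': "range A \<subseteq> lambda_system UNIV UNIV hausdorff1"
      using A(1) borel_subset_caratheodory_hausdorff1 by (rule order_trans)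
    show "(\<Sum>i. hausdorff1 (E \<inter> A i)) = hausdorff1 (E \<inter> (\<Union>i. A i))"
    proof (rule antisym)
      show "hausdorff1 (E \<inter> (\<Union>i. A i)) \<le> (\<Sum>i. hausdorff1 (E \<inter> A i))"
        using hausdorff1_UN_le[of "\<lambda>i. E \<inter> A i"] by simp
      show "(\<Sum>i. hausdorff1 (E \<inter> A i)) \<le> hausdorff1 (E \<inter> (\<Union>i. A i))"
      proof (rule suminf_le_const[OF summableI])
        fix n
        have "(\<Sum>i<n. hausdorff1 (E \<inter> A i)) = hausdorff1 (E \<inter> (\<Union>i\<in>{0..<n}. A i))"
          unfolding lessThan_atLeast0
          using outer_measure_space_hausdorff1 A' A(2)
          by (intro algebra.lambda_system_strong_sum[OF alg]) (auto simp: outer_measure_space_def)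
        also have "\<dots> \<le> hausdorff1 (E \<inter> (\<Union>i. A i))" by (rule hausdorff1_mono) auto
        finally show "(\<Sum>i<n. hausdorff1 (E \<inter> A i)) \<le> hausdorff1 (E \<inter> (\<Union>i. A i))" .
      qed
    qed
  qed
qed (fact B)

section \<open>Ahlfors regularity, rectifiability and Jones' numbers\<close>

definition ahlfors_regular1 :: "(real^2) set \<Rightarrow> bool" where
  "ahlfors_regular1 E \<longleftrightarrow>
     (\<exists>c C. 0 < c \<and> c < C \<and>
       (\<forall>x\<in>E. \<forall>r>0. ennreal r < ediam E \<longrightarrow>
          ennreal (c * r) \<le> hausdorff1 (E \<inter> ball x r) \<and>
          hausdorff1 (E \<inter> ball x r) \<le> ennreal (C * r)))"

definition countably_rectifiable1 :: "(real^2) set \<Rightarrow> bool" where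
  "countably_rectifiable1 E \<longleftrightarrow>
     (\<exists>f :: nat \<Rightarrow> real \<Rightarrow> real^2.
       (\<forall>i. \<exists>L. L-lipschitz_on UNIV (f i)) \<and> hausdorff1 (E - (\<Union>i. range (f i))) = 0)"

definition affine_lines :: "(real^2) set set" where
  "affine_lines = {L. affine L \<and> aff_dim L = 1}"

definition esqrt :: "ennreal \<Rightarrow> ennreal" where
  "esqrt x = (if x = \<infinity> then \<infinity> else ennreal (sqrt (enn2real x)))"

text \<open>Only radii \<open>r > 0\<close> are meaningful.\<close>

definition jones_beta :: "(real^2) set \<Rightarrow> real^2 \<Rightarrow> real \<Rightarrow> ennreal" where
  "jones_beta E x r =
     esqrt (INF L\<in>affine_lines.
       \<integral>\<^sup>+y\<in>ball x r. ennreal ((infdist y L / r)\<^sup>2 / r) \<partial>hausdorff1_restr E)"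

end

theory Submission
  imports Defs
begin

text \<open>
  The set is built from 4-adic squares. Starting with the unit square, every square of side
  \<open>4 ^ -n\<close> is replaced by four of its sixteen subsquares of side \<open>4 ^ -(n + 1)\<close>: a
  \<^emph>\<open>corner split\<close> takes the four corners, as for the four-corner Cantor set, and a
  \<^emph>\<open>straight split\<close> takes the bottom row, which reproduces the bottom edge. The squares of
  level \<open>n\<close> are numbered by \<open>m < 4 ^ n\<close>, and an arbitrary rule \<open>C n m\<close> says which of them are
  split into corners. A parameter \<open>t \<in> [0, 1)\<close> with \<open>m = \<lfloor>4 ^ n t\<rfloor>\<close> selects the \<open>m\<close>-th square at each
  level, and the set consists of the limit points.

  Every such set is Ahlfors regular, whatever the rule: each of the \<open>4 ^ n\<close> squares of level \<open>n\<close>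
  holds the same amount \<open>4 ^ -n\<close> of Lebesgue measure of parameters, and a set of diameter about
  \<open>4 ^ -n\<close> meets boundedly many of them. Hence Hausdorff measure is comparable to the image of
  Lebesgue measure (\<open>hausdorff1_cell_le\<close>, \<open>hausdorff1_cell_ge\<close>). A square with a corner split has
  Jones number bounded below, because no line comes close to all of three corners
  (\<open>line_avoids_corner\<close>, \<open>jones_beta_ge\<close>).

  What remains is to choose the rule. For the set to be rectifiable, almost every point
  should see only finitely many corner splits, since from then on it stays on one horizontal
  line. For the integral to diverge near every point, the number of corner splits must
  nevertheless fail to be integrable over every square. The rule \<open>corner\<close> does both: if the digits
  of an address at positions \<open>k, \<dots>, 2k - 1\<close> all vanish, the next \<open>64 ^ k\<close> levels are corner splits.
  This event has probability \<open>4 ^ -k\<close>, which is summable, so by the Borel--Cantelli argument almost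
  every parameter meets only finitely many of the events
  (\<open>corner_infinitely_often_null\<close>). But every square of level \<open>k\<close> contains a square of level \<open>2k\<close>,
  of measure about \<open>16 ^ -k\<close>, on which at least \<open>64 ^ k\<close> scales contribute, so the integral
  over it is at least a constant times \<open>4 ^ k\<close> (\<open>jones_integral_ge\<close>). Letting \<open>k\<close> grow gives \<open>\<infinity>\<close>.
\<close>

section \<open>Quaternary addresses\<close>

definition idx :: "nat \<Rightarrow> real \<Rightarrow> nat" where
  "idx n t = nat \<lfloor>4 ^ n * t\<rfloor>"

lemma idx_div:
  assumes "0 \<le> t"
  shows "idx (n + j) t div 4 ^ j = idx n t"
proof -
  have "\<lfloor>4 ^ n * t\<rfloor> = \<lfloor>(4 ^ (n + j) * t) / real_of_int (4 ^ j)\<rfloor>"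
    by (simp add: power_add)
  also have "\<dots> = \<lfloor>4 ^ (n + j) * t\<rfloor> div 4 ^ j"
    by (rule floor_divide_real_eq_div) simp
  finally show ?thesis
    unfolding idx_def using assms by (simp add: nat_div_distrib nat_power_eq)
qed

lemma idx_Suc_div: "0 \<le> t \<Longrightarrow> idx (Suc n) t div 4 = idx n t"
  using idx_div[of t n 1] by simp

lemma idx_eq_iff:
  assumes "0 \<le> t"
  shows "idx n t = m \<longleftrightarrow> t \<in> {real m / 4 ^ n ..< (real m + 1) / 4 ^ n}"
proof -
  have "idx n t = m \<longleftrightarrow> \<lfloor>4 ^ n * t\<rfloor> = int m"
    unfolding idx_def using assms by auto
  also have "\<dots> \<longleftrightarrow> t \<in> {real m / 4 ^ n ..< (real m + 1) / 4 ^ n}"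
    by (auto simp: floor_eq_iff field_simps)
  finally show ?thesis .
qed

lemma idx_less: "0 \<le> t \<Longrightarrow> t < 1 \<Longrightarrow> idx n t < 4 ^ n"
  unfolding idx_def by (simp add: nat_less_iff floor_less_iff)

text \<open>
  The real number with base-4 approximations \<open>a n / 4 ^ n\<close>. These increase in the intended use, so
  a supremum replaces the limit.
\<close>

definition quad :: "(nat \<Rightarrow> nat) \<Rightarrow> real" where
  "quad a = (SUP n. real (a n) / 4 ^ n)"

text \<open>The intervals \<open>[a n / 4 ^ n, (a n + 1) / 4 ^ n]\<close> are nested.\<close>

lemma quad_bounds:
  assumes a: "\<And>n. 4 * a n \<le> a (Suc n)" "\<And>n. a (Suc n) \<le> 4 * a n + 3"
  shows "real (a n) \<le> 4 ^ n * quad a" "4 ^ n * quad a \<le> real (a n) + 1"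
proof -
  have inc: "incseq (\<lambda>n. real (a n) / 4 ^ n)"
  proof (rule incseq_SucI)
    fix n
    have "4 * real (a n) \<le> real (a (Suc n))" using a(1)[of n] by linarith
    then show "real (a n) / 4 ^ n \<le> real (a (Suc n)) / 4 ^ Suc n" by (simp add: field_simps)
  qed
  have dec: "decseq (\<lambda>n. (real (a n) + 1) / 4 ^ n)"
  proof (rule decseq_SucI)
    fix n
    have "real (a (Suc n)) + 1 \<le> 4 * (real (a n) + 1)"
      using of_nat_mono[OF a(2)[of n], where 'a = real] by simp
    then show "(real (a (Suc n)) + 1) / 4 ^ Suc n \<le> (real (a n) + 1) / 4 ^ n"
      by (simp add: divide_simps)
  qed
  have le: "real (a i) / 4 ^ i \<le> (real (a n) + 1) / 4 ^ n" for i n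
  proof -
    have "real (a i) / 4 ^ i \<le> real (a (max i n)) / 4 ^ max i n"
      using incseqD[OF inc, of i "max i n"] by simp
    also have "\<dots> \<le> (real (a (max i n)) + 1) / 4 ^ max i n" by (simp add: divide_right_mono)
    also have "\<dots> \<le> (real (a n) + 1) / 4 ^ n"
      using decseqD[OF dec, of n "max i n"] by simp
    finally show ?thesis .
  qed
  have "real (a n) / 4 ^ n \<le> quad a"
    unfolding quad_def by (rule cSUP_upper) (auto intro: bdd_aboveI2[OF le[of _ 0]])
  then show "real (a n) \<le> 4 ^ n * quad a" by (simp add: field_simps)
  have "quad a \<le> (real (a n) + 1) / 4 ^ n"
    unfolding quad_def by (rule cSUP_least) (auto intro: le)
  then show "4 ^ n * quad a \<le> real (a n) + 1" by (simp add: field_simps)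
qed

section \<open>The squares and the set\<close>

text \<open>
  Grid coordinates of the lower left corner of square \<open>m\<close> of level \<open>n\<close>, in units of its side. The last
  base-4 digit of \<open>m\<close> picks the subsquare. In a corner split its low bit gives the side (left or
  right) and its high bit the height.
\<close>

primrec xnum :: "(nat \<Rightarrow> nat \<Rightarrow> bool) \<Rightarrow> nat \<Rightarrow> nat \<Rightarrow> nat" where
  "xnum C 0 m = 0"
| "xnum C (Suc n) m = 4 * xnum C n (m div 4) + (if C n (m div 4) then 3 * (m mod 2) else m mod 4)"

primrec ynum :: "(nat \<Rightarrow> nat \<Rightarrow> bool) \<Rightarrow> nat \<Rightarrow> nat \<Rightarrow> nat" where
  "ynum C 0 m = 0"
| "ynum C (Suc n) m = 4 * ynum C n (m div 4) + (if C n (m div 4) then 3 * (m mod 4 div 2) else 0)"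

definition square :: "(nat \<Rightarrow> nat \<Rightarrow> bool) \<Rightarrow> nat \<Rightarrow> nat \<Rightarrow> (real^2) set" where
  "square C n m = {z. real (xnum C n m) \<le> 4 ^ n * z $ 1 \<and> 4 ^ n * z $ 1 \<le> real (xnum C n m) + 1 \<and>
                      real (ynum C n m) \<le> 4 ^ n * z $ 2 \<and> 4 ^ n * z $ 2 \<le> real (ynum C n m) + 1}"

definition point :: "(nat \<Rightarrow> nat \<Rightarrow> bool) \<Rightarrow> real \<Rightarrow> real^2" where
  "point C t = vector [quad (\<lambda>n. xnum C n (idx n t)), quad (\<lambda>n. ynum C n (idx n t))]"

text \<open>
  The part of the set with a given address. Not the intersection with the square: a neighbouring
  cell may have points on a common edge. The whole set is \<open>cell C 0 0\<close>.
\<close>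

definition cell :: "(nat \<Rightarrow> nat \<Rightarrow> bool) \<Rightarrow> nat \<Rightarrow> nat \<Rightarrow> (real^2) set" where
  "cell C n m = point C ` {t. 0 \<le> t \<and> idx n t = m}"

lemma xnum_step:
  "4 * xnum C n (m div 4) \<le> xnum C (Suc n) m" "xnum C (Suc n) m \<le> 4 * xnum C n (m div 4) + 3"
proof -
  have "m mod 2 \<le> 1" "m mod 4 \<le> 3" by simp_all
  then show "xnum C (Suc n) m \<le> 4 * xnum C n (m div 4) + 3" unfolding xnum.simps by simp
qed simp

lemma ynum_step:
  "4 * ynum C n (m div 4) \<le> ynum C (Suc n) m" "ynum C (Suc n) m \<le> 4 * ynum C n (m div 4) + 3"
proof -
  have "m mod 4 \<le> 3" by simp
  then have "m mod 4 div 2 \<le> 1" using div_le_mono[of "m mod 4" 3 2] by simp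
  then show "ynum C (Suc n) m \<le> 4 * ynum C n (m div 4) + 3" unfolding ynum.simps by simp
qed simp

lemma point_in_square:
  assumes "0 \<le> t"
  shows "point C t \<in> square C n (idx n t)"
proof -
  note xnum_step[of C _ "idx (Suc _) t"] ynum_step[of C _ "idx (Suc _) t"]
  note step = this[unfolded idx_Suc_div[OF assms]]
  show ?thesis
    unfolding square_def point_def mem_Collect_eq vector_2
    by (intro conjI quad_bounds step)
qed

lemma cell_subset_square: "cell C n m \<subseteq> square C n m"
  by (auto simp: cell_def point_in_square)

lemma square_Suc_subset: "square C (Suc n) m \<subseteq> square C n (m div 4)"
proof
  fix z assume "z \<in> square C (Suc n) m"
  then have z: "real (xnum C (Suc n) m) \<le> 4 * (4 ^ n * z $ 1)" "4 * (4 ^ n * z $ 1) \<le> real (xnum C (Suc n) m) + 1"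
    "real (ynum C (Suc n) m) \<le> 4 * (4 ^ n * z $ 2)" "4 * (4 ^ n * z $ 2) \<le> real (ynum C (Suc n) m) + 1"
    unfolding square_def by (auto simp: mult.assoc)
  note step = of_nat_mono[OF xnum_step(1)[of C n m]] of_nat_mono[OF xnum_step(2)[of C n m]]
    of_nat_mono[OF ynum_step(1)[of C n m]] of_nat_mono[OF ynum_step(2)[of C n m]]
  note real_step = step[where 'a = real, unfolded of_nat_mult of_nat_add of_nat_numeral]
  show "z \<in> square C n (m div 4)"
    unfolding square_def mem_Collect_eq
  proof (intro conjI)
    show "real (xnum C n (m div 4)) \<le> 4 ^ n * z $ 1" 
      using z(1) real_step(1) by (simp del: xnum.simps ynum.simps)
    show "4 ^ n * z $ 1 \<le> real (xnum C n (m div 4)) + 1" 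
      using z(2) real_step(2) by (simp del: xnum.simps ynum.simps)
    show "real (ynum C n (m div 4)) \<le> 4 ^ n * z $ 2" 
      using z(3) real_step(3) by (simp del: xnum.simps ynum.simps)
    show "4 ^ n * z $ 2 \<le> real (ynum C n (m div 4)) + 1" 
      using z(4) real_step(4) by (simp del: xnum.simps ynum.simps)
  qed
qed

lemma square_subset_ancestor: "square C (n + j) m \<subseteq> square C n (m div 4 ^ j)"
proof (induction j arbitrary: m)
  case (Suc j)
  have "square C (n + Suc j) m \<subseteq> square C (n + j) (m div 4)"
    using square_Suc_subset[of C "n + j" m] by simp
  also have "\<dots> \<subseteq> square C n (m div 4 div 4 ^ j)" by (rule Suc.IH)
  finally show ?case by (simp add: div_mult2_eq)
qed simp

lemma cell_subset_ancestor: "cell C (n + j) m \<subseteq> cell C n (m div 4 ^ j)"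
  by (auto simp: cell_def idx_div)

lemma cell_subset_root: "m < 4 ^ n \<Longrightarrow> cell C n m \<subseteq> cell C 0 0"
  using cell_subset_ancestor[of C 0 n m] by simp

lemma cell_descendants: "cell C n m = (\<Union>q\<in>{q. q div 4 ^ j = m}. cell C (n + j) q)"
proof (intro equalityI subsetI)
  fix x assume "x \<in> cell C n m"
  then obtain t where t: "0 \<le> t" "idx n t = m" "x = point C t" by (auto simp: cell_def)
  then have "x \<in> cell C (n + j) (idx (n + j) t)" "idx (n + j) t div 4 ^ j = m"
    using idx_div[of t n j] by (auto simp: cell_def)
  then show "x \<in> (\<Union>q\<in>{q. q div 4 ^ j = m}. cell C (n + j) q)" by blast
next
  fix x assume "x \<in> (\<Union>q\<in>{q. q div 4 ^ j = m}. cell C (n + j) q)"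
  then show "x \<in> cell C n m" using cell_subset_ancestor[of C n j] by auto
qed

lemma root_cell_cases:
  assumes "x \<in> cell C 0 0"
  obtains t where "0 \<le> t" "t < 1" "x = point C t"
  using assms by (auto simp: cell_def idx_eq_iff)

lemma square_dist:
  assumes "x \<in> square C n m" "y \<in> square C n m"
  shows "dist x y \<le> 2 / 4 ^ n"
proof -
  have "\<bar>4 ^ n * (x $ 1 - y $ 1)\<bar> \<le> 1" "\<bar>4 ^ n * (x $ 2 - y $ 2)\<bar> \<le> 1"
    using assms unfolding square_def by (auto simp: algebra_simps abs_le_iff)
  then have "\<bar>x $ 1 - y $ 1\<bar> \<le> 1 / 4 ^ n" "\<bar>x $ 2 - y $ 2\<bar> \<le> 1 / 4 ^ n"
    by (simp_all add: abs_mult pos_le_divide_eq mult.commute)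
  moreover have "dist x y \<le> \<bar>x $ 1 - y $ 1\<bar> + \<bar>x $ 2 - y $ 2\<bar>"
    using norm_le_l1_cart[of "x - y"] by (simp add: dist_norm sum_2)
  ultimately show ?thesis by simp
qed

lemma closed_square: "closed (square C n m)"
  unfolding square_def by (intro closed_Collect_conj closed_Collect_le continuous_intros)

text \<open>Distinct addresses give distinct grid squares, which turns counting cells into counting squares.\<close>

lemma inj_on_xnum_ynum: "inj_on (\<lambda>m. (xnum C n m, ynum C n m)) {..<4 ^ n}"
proof (induction n)
  case (Suc n)
  show ?case
  proof (rule inj_onI)
    fix p q assume pq: "p \<in> {..<4 ^ Suc n}" "q \<in> {..<4 ^ Suc n}"
      and eq: "(xnum C (Suc n) p, ynum C (Suc n) p) = (xnum C (Suc n) q, ynum C (Suc n) q)"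
    have "xnum C n (p div 4) = xnum C n (q div 4)" "ynum C n (p div 4) = ynum C n (q div 4)"
      using eq xnum_step[of C n p] xnum_step[of C n q] ynum_step[of C n p] ynum_step[of C n q]
      unfolding prod.inject by linarith+
    moreover have "p div 4 \<in> {..<4 ^ n}" "q div 4 \<in> {..<4 ^ n}" using pq by auto
    ultimately have par: "p div 4 = q div 4"
      using inj_onD[OF Suc, of "p div 4" "q div 4"] by simp
    have "p mod 4 = q mod 4"
    proof (cases "C n (p div 4)")
      case True
      then have Cq: "C n (q div 4)" using par by simp
      have "3 * (p mod 2) = 3 * (q mod 2)" "3 * (p mod 4 div 2) = 3 * (q mod 4 div 2)"
        using eq unfolding xnum.simps ynum.simps prod.inject par if_P[OF Cq] by linarith+
      then have *: "p mod 2 = q mod 2" "p mod 4 div 2 = q mod 4 div 2" by linarith+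
      have digit: "i mod 4 = 2 * (i mod 4 div 2) + i mod 2" for i :: nat
        using mult_div_mod_eq[of 2 "i mod 4"] mod_mod_cancel[of 2 4 i] by simp
      show ?thesis using * digit[of p] digit[of q] by linarith
    next
      case False
      then have "\<not> C n (q div 4)" using par by simp
      then show ?thesis using eq unfolding xnum.simps prod.inject par by simp
    qed
    with par show "p = q" using mult_div_mod_eq[of 4 p] mult_div_mod_eq[of 4 q] by linarith
  qed
qed (simp add: inj_on_def)

section \<open>Upper bounds for Hausdorff measure\<close>

lemma ediam_le: "(\<And>x y. x \<in> S \<Longrightarrow> y \<in> S \<Longrightarrow> dist x y \<le> d) \<Longrightarrow> ediam S \<le> ennreal d"
  unfolding ediam_def by (intro SUP_least ennreal_leI) auto

lemma ediam_cell: "ediam (cell C n m) \<le> ennreal (2 / 4 ^ n)"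
  using cell_subset_square[of C n m] by (intro ediam_le square_dist) auto

text \<open>Used for passing from a radius to the matching 4-adic level.\<close>

lemma exists_scale:
  fixes r a :: real
  assumes "0 < r" "r \<le> a"
  obtains n where "a / 4 ^ Suc n < r" "r \<le> a / 4 ^ n"
proof -
  obtain k where "a / r < 4 ^ k" using real_arch_pow[of 4 "a / r"] by auto
  then have "\<exists>n. a / 4 ^ n < r" using assms(1) by (intro exI[of _ k]) (simp add: field_simps)
  then obtain n where n: "a / 4 ^ n < r" "\<And>i. i < n \<Longrightarrow> \<not> a / 4 ^ i < r"
    using exists_least_iff[of "\<lambda>n. a / 4 ^ n < r"] by auto
  then obtain p where "n = Suc p" using assms(2) by (cases n) auto
  then show ?thesis using n(1) n(2)[of p] that by auto
qed

text \<open>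
  The descendants of a cell \<open>j\<close> levels down are \<open>4 ^ j\<close> sets of diameter at most \<open>2 / 4 ^ (n + j)\<close>, so
  covers by descendants of any generation have the same total diameter bound.
\<close>

lemma hausdorff1_cell_le: "hausdorff1 (cell C n m) \<le> ennreal (2 / 4 ^ n)"
  unfolding hausdorff1_def
proof (rule SUP_least)
  fix d :: real assume "d \<in> {0<..}"
  then obtain j where j: "2 / 4 ^ j < d"
    using exists_scale[of "min d 2" 2] by (metis greaterThan_iff min.cobounded2 min_less_iff_conj order.strict_trans2 zero_less_numeral)
  define U where "U i = (if i < 4 ^ j then cell C (n + j) (m * 4 ^ j + i) else {})" for i
  have U: "ediam (U i) \<le> ennreal (2 / 4 ^ (n + j))" for i
    unfolding U_def by (simp add: ediam_cell)
  have "2 / 4 ^ (n + j) \<le> (2 / 4 ^ j :: real)" by (rule divide_left_mono) (auto simp: power_increasing)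
  then have small: "ediam (U i) \<le> ennreal d" for i
    using U[of i] j by (meson ennreal_leI less_imp_le order_trans)
  have cover: "cell C n m \<subseteq> (\<Union>i. U i)"
  proof
    fix x assume "x \<in> cell C n m"
    then obtain q where q: "q div 4 ^ j = m" "x \<in> cell C (n + j) q"
      using cell_descendants[of C n m j] by auto
    then have "x \<in> U (q mod 4 ^ j)" unfolding U_def using div_mult_mod_eq[of q "4 ^ j"] by simp
    then show "x \<in> (\<Union>i. U i)" by blast
  qed
  have "hausdorff1_pre d (cell C n m) \<le> (\<Sum>i. ediam (U i))"
    using cover small by (rule hausdorff1_pre_le)
  also have "\<dots> = (\<Sum>i<4 ^ j. ediam (U i))" by (rule suminf_finite) (auto simp: U_def)
  also have "\<dots> \<le> (\<Sum>i<(4::nat) ^ j. ennreal (2 / 4 ^ (n + j)))" by (intro sum_mono U)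
  also have "\<dots> = ennreal (4 ^ j * (2 / 4 ^ (n + j)))"
    by (simp add: ennreal_of_nat_eq_real_of_nat flip: ennreal_mult)
  also have "4 ^ j * (2 / 4 ^ (n + j)) = (2 / 4 ^ n :: real)" by (simp add: power_add)
  finally show "hausdorff1_pre d (cell C n m) \<le> ennreal (2 / 4 ^ n)" .
qed

lemma hausdorff1_UN_finite_le:
  assumes "finite I"
  shows "hausdorff1 (\<Union>i\<in>I. A i) \<le> (\<Sum>i\<in>I. hausdorff1 (A i))"
  using assms
proof (induction I)
  case (insert i I)
  then show ?case by simp (meson add_left_mono hausdorff1_Un_le order_trans)
qed simp

text \<open>
  In units of the side, points of \<open>S\<close> differ by at most 2 in each coordinate, so the grid
  coordinates of the squares containing them differ by at most 3: at most 7 columns and 7 rows.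
\<close>

lemma card_cells_met:
  assumes S: "\<And>x y. x \<in> S \<Longrightarrow> y \<in> S \<Longrightarrow> dist x y \<le> 2 / 4 ^ n"
  shows "card {m. m < 4 ^ n \<and> cell C n m \<inter> S \<noteq> {}} \<le> 49" (is "card ?M \<le> 49")
proof (cases "?M = {}")
  case False
  then obtain p x where p: "x \<in> cell C n p" "x \<in> S" by auto
  let ?N = "{xnum C n p - 3..xnum C n p + 3} \<times> {ynum C n p - 3..ynum C n p + 3}"
  have "card ?M \<le> card ?N"
  proof (rule card_inj_on_le)
    show "inj_on (\<lambda>m. (xnum C n m, ynum C n m)) ?M"
      by (rule inj_on_subset[OF inj_on_xnum_ynum]) auto
    show "(\<lambda>m. (xnum C n m, ynum C n m)) ` ?M \<subseteq> ?N"
    proof clarify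
      fix m assume "cell C n m \<inter> S \<noteq> {}"
      then obtain y where y: "y \<in> cell C n m" "y \<in> S" by auto
      have "\<bar>x $ i - y $ i\<bar> \<le> 2 / 4 ^ n" for i
        using S[OF p(2) y(2)] component_le_norm_cart[of "x - y" i] by (simp add: dist_norm)
      then have d: "\<bar>4 ^ n * x $ i - 4 ^ n * y $ i\<bar> \<le> 2" for i
        unfolding right_diff_distrib[symmetric] abs_mult by (simp add: field_simps)
      have "x \<in> square C n p" "y \<in> square C n m"
        using p y cell_subset_square by blast+
      then have "real (xnum C n m) \<le> real (xnum C n p) + 3" "real (xnum C n p) \<le> real (xnum C n m) + 3"
        "real (ynum C n m) \<le> real (ynum C n p) + 3" "real (ynum C n p) \<le> real (ynum C n m) + 3"
        using d[of 1] d[of 2] unfolding square_def mem_Collect_eq by linarith+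
      then show "xnum C n m \<in> {xnum C n p - 3..xnum C n p + 3} \<and>
          ynum C n m \<in> {ynum C n p - 3..ynum C n p + 3}"
        unfolding atLeastAtMost_iff by linarith
    qed
  qed simp
  also have "\<dots> \<le> 7 * 7" unfolding card_cartesian_product by (intro mult_mono) auto
  finally show ?thesis by simp
next
  case True
  then show ?thesis unfolding True by simp
qed

lemma hausdorff1_inter_le:
  assumes S: "\<And>x y. x \<in> S \<Longrightarrow> y \<in> S \<Longrightarrow> dist x y \<le> 2 / 4 ^ n"
  shows "hausdorff1 (cell C 0 0 \<inter> S) \<le> ennreal (98 / 4 ^ n)"
proof -
  let ?M = "{m. m < 4 ^ n \<and> cell C n m \<inter> S \<noteq> {}}"
  have "cell C 0 0 \<inter> S \<subseteq> (\<Union>m\<in>?M. cell C n m)"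
  proof
    fix x assume x: "x \<in> cell C 0 0 \<inter> S"
    then obtain t where t: "0 \<le> t" "t < 1" "x = point C t" by (auto elim: root_cell_cases)
    then have "x \<in> cell C n (idx n t)" by (auto simp: cell_def)
    then show "x \<in> (\<Union>m\<in>?M. cell C n m)" using x idx_less[OF t(1,2), of n]
      by (intro UN_I[of "idx n t"]) auto
  qed
  then have "hausdorff1 (cell C 0 0 \<inter> S) \<le> hausdorff1 (\<Union>m\<in>?M. cell C n m)"
    by (rule hausdorff1_mono)
  also have "\<dots> \<le> (\<Sum>m\<in>?M. hausdorff1 (cell C n m))" by (rule hausdorff1_UN_finite_le) simp
  also have "\<dots> \<le> (\<Sum>m\<in>?M. ennreal (2 / 4 ^ n))" by (intro sum_mono hausdorff1_cell_le)
  also have "\<dots> = ennreal (real (card ?M) * (2 / 4 ^ n))"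
    by (simp add: ennreal_of_nat_eq_real_of_nat flip: ennreal_mult)
  also have "\<dots> \<le> ennreal (98 / 4 ^ n)"
  proof (rule ennreal_leI)
    have "real (card ?M) * (2 / 4 ^ n) \<le> 49 * (2 / 4 ^ n)"
      using card_cells_met[OF S, where C = C] by (intro mult_right_mono) auto
    then show "real (card ?M) * (2 / 4 ^ n) \<le> 98 / 4 ^ n" by simp
  qed
  finally show ?thesis .
qed

section \<open>Lower bounds for Hausdorff measure\<close>

lemma emeasure_idx: "emeasure lborel {t. 0 \<le> t \<and> idx n t = m} = ennreal (1 / 4 ^ n)"
  and sets_idx: "{t. 0 \<le> t \<and> idx n t = m} \<in> sets borel"
proof -
  have pos: "0 \<le> t" if "t \<in> {real m / 4 ^ n ..< (real m + 1) / 4 ^ n}" for t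
    using that order_trans[of 0 "real m / 4 ^ n" t] by simp
  have iff: "0 \<le> t \<and> idx n t = m \<longleftrightarrow> t \<in> {real m / 4 ^ n ..< (real m + 1) / 4 ^ n}" for t
    using idx_eq_iff[of t n m] pos[of t] by (cases "0 \<le> t") auto
  have eq: "{t. 0 \<le> t \<and> idx n t = m} = {real m / 4 ^ n ..< (real m + 1) / 4 ^ n}"
    unfolding iff by auto
  show "{t. 0 \<le> t \<and> idx n t = m} \<in> sets borel" unfolding eq by simp
  have "real m / 4 ^ n \<le> (real m + 1) / 4 ^ n" by (simp add: divide_right_mono)
  then show "emeasure lborel {t. 0 \<le> t \<and> idx n t = m} = ennreal (1 / 4 ^ n)"
    unfolding eq by (simp flip: diff_divide_distrib)
qed

text \<open>
  The next three lemmas are the mass distribution principle for the image of Lebesgue measure. The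
  preimage of a covering set need not be measurable, so it is enclosed in a Borel set made of address
  intervals.
\<close>

lemma preimage_measure_scale:
  assumes S: "ediam S \<le> ennreal (1 / 4 ^ n)"
  shows "\<exists>V. V \<in> sets borel \<and> {t. 0 \<le> t \<and> t < 1 \<and> point C t \<in> S} \<subseteq> V \<and>
    emeasure lborel V \<le> ennreal (49 / 4 ^ n)"
proof (intro exI conjI)
  let ?M = "{m. m < 4 ^ n \<and> cell C n m \<inter> S \<noteq> {}}"
  let ?V = "\<Union>m\<in>?M. {t. 0 \<le> t \<and> idx n t = m}"
  have fin: "finite ?M" by simp
  show "?V \<in> sets borel" using fin by (intro sets.finite_UN sets_idx) auto
  show "{t. 0 \<le> t \<and> t < 1 \<and> point C t \<in> S} \<subseteq> ?V"
    using idx_less by (fastforce simp: cell_def)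
  have "dist x y \<le> 2 / 4 ^ n" if "x \<in> S" "y \<in> S" for x y
  proof -
    have "ennreal (dist x y) \<le> ennreal (1 / 4 ^ n)" using dist_le_ediam[OF that] S by (rule order_trans)
    then have "dist x y \<le> 1 / 4 ^ n" by (subst (asm) ennreal_le_iff) auto
    also have "\<dots> \<le> 2 / 4 ^ n" by (simp add: divide_right_mono)
    finally show ?thesis .
  qed
  note card = card_cells_met[OF this, where C = C]
  have "emeasure lborel ?V \<le> (\<Sum>m\<in>?M. emeasure lborel {t. 0 \<le> t \<and> idx n t = m})"
    using fin sets_idx by (intro emeasure_subadditive_finite) auto
  also have "\<dots> = ennreal (real (card ?M) * (1 / 4 ^ n))"
    by (simp add: emeasure_idx ennreal_of_nat_eq_real_of_nat flip: ennreal_mult)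
  also have "\<dots> \<le> ennreal (49 / 4 ^ n)"
    using card by (intro ennreal_leI) (simp add: divide_right_mono)
  finally show "emeasure lborel ?V \<le> ennreal (49 / 4 ^ n)" .
qed

lemma preimage_measure:
  assumes S: "ediam S \<le> 1"
  shows "\<exists>V. V \<in> sets borel \<and> {t. 0 \<le> t \<and> t < 1 \<and> point C t \<in> S} \<subseteq> V \<and>
    emeasure lborel V \<le> 196 * ediam S" (is "\<exists>V. _ \<and> ?T \<subseteq> V \<and> _")
proof (cases "ediam S = 0")
  case False
  obtain d where d: "ediam S = ennreal d" "0 < d" "d \<le> 1"
    using S False by (cases "ediam S") (auto simp: top_unique less_le)
  obtain n where n: "1 / 4 ^ Suc n < d" "d \<le> 1 / 4 ^ n" using exists_scale[OF d(2,3)] .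
  have "ediam S \<le> ennreal (1 / 4 ^ n)" unfolding d(1) using n(2) by (rule ennreal_leI)
  from preimage_measure_scale[OF this, of C] obtain V
    where V: "V \<in> sets borel" "?T \<subseteq> V" "emeasure lborel V \<le> ennreal (49 / 4 ^ n)" by blast
  have "49 / 4 ^ n \<le> 196 * d" using n(1) by (simp add: field_simps)
  then have "emeasure lborel V \<le> ennreal (196 * d)" using V(3) by (meson ennreal_leI order_trans)
  then have "emeasure lborel V \<le> 196 * ediam S" using d by (simp add: ennreal_mult)
  then show ?thesis using V(1,2) by blast
next
  \<comment> \<open>No single scale matches diameter 0: intersect over all scales.\<close>
  case True
  have ex: "\<exists>V. V \<in> sets borel \<and> ?T \<subseteq> V \<and> emeasure lborel V \<le> ennreal (49 / 4 ^ n)" for n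
    using True by (intro preimage_measure_scale) simp
  obtain V where "\<forall>n. V n \<in> sets borel \<and> ?T \<subseteq> V n \<and> emeasure lborel (V n) \<le> ennreal (49 / 4 ^ n)"
    using choice[OF allI[OF ex]] by (rule exE)
  then have V: "\<And>n. V n \<in> sets borel" "\<And>n. ?T \<subseteq> V n"
    "\<And>n. emeasure lborel (V n) \<le> ennreal (49 / 4 ^ n)" by blast+
  have "emeasure lborel (\<Inter>n. V n) \<le> 0"
  proof (rule ennreal_le_epsilon)
    fix e :: real assume "0 < e"
    obtain n where n: "49 / 4 ^ Suc n < min e 49"
      using \<open>0 < e\<close> by (auto intro: exists_scale[of "min e 49" 49])
    have "emeasure lborel (\<Inter>n. V n) \<le> emeasure lborel (V (Suc n))"
      using V(1) by (intro emeasure_mono) auto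
    also have "\<dots> \<le> ennreal (49 / 4 ^ Suc n)" by (rule V(3))
    also have "\<dots> \<le> ennreal e" using n by (intro ennreal_leI) simp
    finally show "emeasure lborel (\<Inter>n. V n) \<le> 0 + ennreal e" by simp
  qed
  moreover have "(\<Inter>n. V n) \<in> sets borel" using V(1) by (intro sets.countable_INT'') auto
  moreover have "?T \<subseteq> (\<Inter>n. V n)" using V(2) by blast
  ultimately show ?thesis using True by (intro exI[of _ "\<Inter>n. V n"] conjI) auto
qed

lemma hausdorff1_cell_ge:
  assumes "m < 4 ^ n"
  shows "ennreal (1 / (196 * 4 ^ n)) \<le> hausdorff1 (cell C n m)"
proof -
  let ?T = "{t. 0 \<le> t \<and> idx n t = m}"
  have T: "t < 1" if "t \<in> ?T" for t
  proof -
    have "t < (real m + 1) / 4 ^ n" using that idx_eq_iff[of t n m] by auto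
    also have "\<dots> \<le> 1"
      using of_nat_mono[OF Suc_leI[OF assms], where 'a = real] by (simp add: add.commute)
    finally show ?thesis .
  qed
  have mass: "ennreal (1 / 4 ^ n) \<le> 196 * (\<Sum>i. ediam (U i))"
    if U: "cell C n m \<subseteq> (\<Union>i. U i)" "\<And>i. ediam (U i) \<le> ennreal 1" for U :: "nat \<Rightarrow> (real^2) set"
  proof -
    have ex: "\<exists>V. V \<in> sets borel \<and> {t. 0 \<le> t \<and> t < 1 \<and> point C t \<in> U i} \<subseteq> V \<and>
      emeasure lborel V \<le> 196 * ediam (U i)" for i
      using U(2)[of i] by (intro preimage_measure) simp
    obtain V where "\<forall>i. V i \<in> sets borel \<and> {t. 0 \<le> t \<and> t < 1 \<and> point C t \<in> U i} \<subseteq> V i \<and>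
      emeasure lborel (V i) \<le> 196 * ediam (U i)"
      using choice[OF allI[OF ex]] by (rule exE)
    then have V: "\<And>i. V i \<in> sets borel"
      "\<And>i. {t. 0 \<le> t \<and> t < 1 \<and> point C t \<in> U i} \<subseteq> V i"
      "\<And>i. emeasure lborel (V i) \<le> 196 * ediam (U i)" by blast+
    have sub: "?T \<subseteq> (\<Union>i. V i)"
    proof
      fix t assume t: "t \<in> ?T"
      then have "point C t \<in> cell C n m" by (auto simp: cell_def)
      then obtain i where "point C t \<in> U i" using U(1) by blast
      then show "t \<in> (\<Union>i. V i)" using V(2)[of i] t T[OF t] by auto
    qed
    have "ennreal (1 / 4 ^ n) = emeasure lborel ?T" by (simp add: emeasure_idx)
    also have "\<dots> \<le> emeasure lborel (\<Union>i. V i)" using V(1) sub by (intro emeasure_mono) auto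
    also have "\<dots> \<le> (\<Sum>i. emeasure lborel (V i))"
      using V(1) by (intro emeasure_subadditive_countably) auto
    also have "\<dots> \<le> (\<Sum>i. 196 * ediam (U i))" by (intro suminf_le V(3)) auto
    finally show ?thesis by simp
  qed
  have "ennreal (1 / (196 * 4 ^ n)) \<le> hausdorff1_pre 1 (cell C n m)"
    unfolding hausdorff1_pre_def
  proof (intro INF_greatest, clarify)
    fix U :: "nat \<Rightarrow> (real^2) set"
    assume U: "cell C n m \<subseteq> (\<Union>i. U i)" "\<forall>i. ediam (U i) \<le> ennreal 1"
    have "ennreal (1 / (196 * 4 ^ n)) = ennreal (1 / 196) * ennreal (1 / 4 ^ n)"
      by (simp flip: ennreal_mult)
    also have "\<dots> \<le> ennreal (1 / 196) * (196 * (\<Sum>i. ediam (U i)))"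
      using mass[of U] U by (intro mult_left_mono) auto
    also have "\<dots> = (\<Sum>i. ediam (U i))"
      by (simp add: mult.assoc[symmetric] flip: ennreal_mult ennreal_numeral del: ennreal_suminf_cmult)
    finally show "ennreal (1 / (196 * 4 ^ n)) \<le> (\<Sum>i. ediam (U i))" .
  qed
  also have "\<dots> \<le> hausdorff1 (cell C n m)" by (rule hausdorff1_pre_le_hausdorff1) simp
  finally show ?thesis .
qed

text \<open>
  For the lower bound, a ball about a point of the set contains the cell of that point at the first
  level with diameter below the radius. The upper bound is \<open>hausdorff1_inter_le\<close>.
\<close>

lemma ahlfors_regular1_root: "ahlfors_regular1 (cell C 0 0)"
  unfolding ahlfors_regular1_def
proof (intro exI conjI ballI allI impI)
  show "(0::real) < 1 / 1568" "1 / 1568 < (392::real)" by simp_all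
  fix x r assume x: "x \<in> cell C 0 0" and r: "0 < r" "ennreal r < ediam (cell C 0 0)"
  have "ennreal r < ennreal (2 / 4 ^ 0)" using r(2) ediam_cell[of C 0 0] by (rule order.strict_trans2)
  then have r2: "r \<le> 2" using r(1) by (subst (asm) ennreal_less_iff) auto
  obtain t where t: "0 \<le> t" "t < 1" "x = point C t" using x by (rule root_cell_cases)
  obtain n where n: "2 / 4 ^ Suc n < r" "r \<le> 2 / 4 ^ n" using exists_scale[OF r(1) r2] .
  let ?m = "idx (Suc n) t"
  have m: "?m < 4 ^ Suc n" using t idx_less by blast
  have "x \<in> cell C (Suc n) ?m" using t by (auto simp: cell_def)
  then have "x \<in> square C (Suc n) ?m" using cell_subset_square by blast
  then have "dist x y < r" if "y \<in> cell C (Suc n) ?m" for y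
    using square_dist[of x C "Suc n" ?m y] n(1) that cell_subset_square[of C "Suc n" ?m] by auto
  then have "cell C (Suc n) ?m \<subseteq> cell C 0 0 \<inter> ball x r"
    using cell_subset_root[OF m, of C] by auto
  then have "hausdorff1 (cell C (Suc n) ?m) \<le> hausdorff1 (cell C 0 0 \<inter> ball x r)"
    by (rule hausdorff1_mono)
  moreover have "ennreal (1 / 1568 * r) \<le> ennreal (1 / (196 * 4 ^ Suc n))"
    using n(2) by (intro ennreal_leI) (simp add: field_simps)
  ultimately show "ennreal (1 / 1568 * r) \<le> hausdorff1 (cell C 0 0 \<inter> ball x r)"
    using hausdorff1_cell_ge[OF m, of C] by (meson order_trans)
  show "hausdorff1 (cell C 0 0 \<inter> ball x r) \<le> ennreal (392 * r)"
  proof (cases "r \<le> 1")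
    case True
    obtain n where n: "1 / 4 ^ Suc n < r" "r \<le> 1 / 4 ^ n" using exists_scale[OF r(1) True] .
    have "hausdorff1 (cell C 0 0 \<inter> ball x r) \<le> ennreal (98 / 4 ^ n)"
    proof (rule hausdorff1_inter_le)
      fix y z assume "y \<in> ball x r" "z \<in> ball x r"
      then have "dist y z \<le> r + r" using dist_triangle3[of y z x] by simp
      then show "dist y z \<le> 2 / 4 ^ n" using n(2) by simp
    qed
    also have "\<dots> \<le> ennreal (392 * r)" using n(1) by (intro ennreal_leI) (simp add: field_simps)
    finally show ?thesis .
  next
    case False
    have "hausdorff1 (cell C 0 0 \<inter> ball x r) \<le> hausdorff1 (cell C 0 0)" by (rule hausdorff1_mono) simp
    also have "\<dots> \<le> ennreal 2" using hausdorff1_cell_le[of C 0 0] by simp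
    also have "\<dots> \<le> ennreal (392 * r)" using False by (intro ennreal_leI) simp
    finally show ?thesis .
  qed
qed


section \<open>Rectifiability\<close>

text \<open>Straight splits append the digit 0 to the second coordinate, so its expansion terminates.\<close>

lemma straight_on_horizontal_line:
  assumes t: "0 \<le> t" and straight: "\<And>n. k \<le> n \<Longrightarrow> \<not> C n (idx n t)"
  shows "point C t $ 2 = real (ynum C k (idx k t)) / 4 ^ k"
proof -
  let ?y = "point C t $ 2" and ?Y = "ynum C k (idx k t)"
  have Y: "ynum C (k + j) (idx (k + j) t) = 4 ^ j * ?Y" for j
  proof (induction j)
    case (Suc j)
    then show ?case using straight[of "k + j"] idx_Suc_div[OF t, of "k + j"] by simp
  qed simp
  have "real (ynum C n (idx n t)) \<le> 4 ^ n * ?y \<and> 4 ^ n * ?y \<le> real (ynum C n (idx n t)) + 1" for n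
    using point_in_square[OF t, of C n] unfolding square_def by blast
  from this[of "k + _", unfolded Y]
  have b: "4 ^ j * real ?Y \<le> 4 ^ j * (4 ^ k * ?y)" "4 ^ j * (4 ^ k * ?y) \<le> 4 ^ j * real ?Y + 1" for j
    by (simp_all add: power_add algebra_simps)
  have "4 ^ k * ?y \<le> real ?Y"
  proof (rule ccontr)
    define e where "e = 4 ^ k * ?y - real ?Y"
    assume "\<not> 4 ^ k * ?y \<le> real ?Y"
    then have "0 < e" by (simp add: e_def)
    obtain j where "1 / e < 4 ^ j" using real_arch_pow[of 4 "1 / e"] by auto
    with \<open>0 < e\<close> have "1 < 4 ^ j * e" by (simp add: field_simps)
    moreover have "4 ^ j * e \<le> 1" using b(2)[of j] unfolding e_def by (simp add: right_diff_distrib)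
    ultimately show False by simp
  qed
  then have "4 ^ k * ?y = real ?Y" using b(1)[of 0] by simp
  then show ?thesis by (simp add: field_simps)
qed

text \<open>
  The number \<open>m div 4 ^ (n - 2 * k)\<close> is the ancestor of \<open>m\<close> at level \<open>2 * k\<close>; divisibility by \<open>4 ^ k\<close>
  says that the second half of its digits vanishes.
\<close>

definition corner :: "nat \<Rightarrow> nat \<Rightarrow> bool" where
  "corner n m \<longleftrightarrow> (\<exists>k. 2 * k \<le> n \<and> n \<le> 2 * k + 64 ^ k \<and> 4 ^ k dvd m div 4 ^ (n - 2 * k))"

text \<open>
  Each \<open>k\<close> accounts for finitely many levels, so infinitely many corner splits involve infinitely many
  \<open>k\<close>. The points for which \<open>k\<close> occurs lie in \<open>4 ^ k\<close> cells of level \<open>2 * k\<close>, of total measure at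
  most \<open>2 / 4 ^ k\<close>, a convergent series.
\<close>

lemma corner_infinitely_often_null:
  "hausdorff1 {x. \<exists>t. 0 \<le> t \<and> t < 1 \<and> x = point corner t \<and> (\<forall>k. \<exists>n\<ge>k. corner n (idx n t))} = 0"
  (is "hausdorff1 ?A = 0")
proof -
  define Z where "Z k = (\<Union>j\<in>{..<4 ^ k}. cell corner (2 * k) (j * 4 ^ k))" for k :: nat
  have Z: "hausdorff1 (Z k) \<le> ennreal (2 * (1 / 4) ^ k)" for k
  proof -
    have "hausdorff1 (Z k) \<le> (\<Sum>j\<in>{..<4 ^ k}. hausdorff1 (cell corner (2 * k) (j * 4 ^ k)))"
      unfolding Z_def by (rule hausdorff1_UN_finite_le) simp
    also have "\<dots> \<le> (\<Sum>j\<in>{..<(4::nat) ^ k}. ennreal (2 / 4 ^ (2 * k)))"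
      by (intro sum_mono hausdorff1_cell_le)
    also have "\<dots> = ennreal (4 ^ k * (2 / 4 ^ (2 * k)))"
      by (simp add: ennreal_of_nat_eq_real_of_nat flip: ennreal_mult)
    also have "4 ^ k * (2 / 4 ^ (2 * k)) = (2 * (1 / 4) ^ k :: real)"
      by (simp add: mult_2 power_add power_divide)
    finally show ?thesis .
  qed
  have sub: "?A \<subseteq> (\<Union>k. Z (k + K))" for K
  proof
    fix x assume "x \<in> ?A"
    then obtain t where t: "0 \<le> t" "t < 1" "x = point corner t" "\<And>k. \<exists>n\<ge>k. corner n (idx n t)"
      by blast
    obtain n where n: "2 * K + 64 ^ K < n" "corner n (idx n t)" using t(4) Suc_le_lessD by blast
    then obtain k where k: "2 * k \<le> n" "n \<le> 2 * k + 64 ^ k" "4 ^ k dvd idx n t div 4 ^ (n - 2 * k)"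
      unfolding corner_def by blast
    have "K \<le> k"
    proof (rule ccontr)
      assume "\<not> K \<le> k"
      then have "2 * k + 64 ^ k \<le> 2 * K + (64::nat) ^ K" by (intro add_mono power_increasing) auto
      then show False using n(1) k(2) by linarith
    qed
    have "4 ^ k dvd idx (2 * k) t" using k idx_div[OF t(1), of "2 * k" "n - 2 * k"] by simp
    then obtain j where j: "idx (2 * k) t = j * 4 ^ k" by (metis dvdE mult.commute)
    have "j * 4 ^ k < 4 ^ (2 * k)" using idx_less[OF t(1,2), of "2 * k"] j by simp
    then have "j < 4 ^ k" by (simp add: mult_2 power_add)
    moreover have "x \<in> cell corner (2 * k) (j * 4 ^ k)" using t j unfolding cell_def by blast
    ultimately have "x \<in> Z (k - K + K)" unfolding Z_def using \<open>K \<le> k\<close> by auto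
    then show "x \<in> (\<Union>k. Z (k + K))" by blast
  qed
  have "hausdorff1 ?A \<le> ennreal (8 / 3 * (1 / 4) ^ K)" for K
  proof -
    have "hausdorff1 ?A \<le> (\<Sum>k. hausdorff1 (Z (k + K)))"
      using hausdorff1_mono[OF sub] hausdorff1_UN_le by (rule order_trans)
    also have "\<dots> \<le> (\<Sum>k. ennreal (2 * (1 / 4) ^ (k + K)))" by (intro suminf_le Z) auto
    also have "\<dots> = ennreal (8 / 3 * (1 / 4) ^ K)"
    proof (rule suminf_ennreal_eq)
      have "(\<lambda>k. 2 * (1 / 4) ^ K * (1 / 4) ^ k) sums (2 * (1 / 4) ^ K * (1 / (1 - 1 / 4 :: real)))"
        by (intro sums_mult geometric_sums) simp
      then show "(\<lambda>k. 2 * (1 / 4) ^ (k + K)) sums (8 / 3 * (1 / 4) ^ K :: real)"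
        by (simp add: power_add mult_ac)
    qed simp
    finally show ?thesis .
  qed
  note bound = this
  have "hausdorff1 ?A \<le> 0"
  proof (rule ennreal_le_epsilon)
    fix e :: real assume "0 < e"
    then obtain K where "(1 / 4) ^ K < 3 / 8 * e" using real_arch_pow_inv[of "3 / 8 * e" "1 / 4"] by auto
    then have "ennreal (8 / 3 * (1 / 4) ^ K) \<le> ennreal e" by (intro ennreal_leI) simp
    with bound[of K] show "hausdorff1 ?A \<le> 0 + ennreal e" by simp
  qed
  then show ?thesis by simp
qed

text \<open>The horizontal lines at heights \<open>p / 4 ^ q\<close> cover everything but the null set above.\<close>

lemma countably_rectifiable1_root: "countably_rectifiable1 (cell corner 0 0)"
proof -
  define h where "h i = real (fst (prod_decode i)) / 4 ^ snd (prod_decode i)" for i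
  define f :: "nat \<Rightarrow> real \<Rightarrow> real^2" where "f i s = vector [s, h i]" for i s
  have lip: "1-lipschitz_on UNIV (f i)" for i
  proof (rule lipschitz_onI)
    fix s u :: real
    show "dist (f i s) (f i u) \<le> 1 * dist s u"
      using norm_le_l1_cart[of "f i s - f i u"] by (simp add: dist_norm f_def sum_2)
  qed simp
  have "cell corner 0 0 - (\<Union>i. range (f i)) \<subseteq>
      {x. \<exists>t. 0 \<le> t \<and> t < 1 \<and> x = point corner t \<and> (\<forall>k. \<exists>n\<ge>k. corner n (idx n t))}"
  proof
    fix x assume x: "x \<in> cell corner 0 0 - (\<Union>i. range (f i))"
    then have "x \<in> cell corner 0 0" by blast
    then obtain t where t: "0 \<le> t" "t < 1" "x = point corner t" by (rule root_cell_cases)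
    have "\<exists>n\<ge>k. corner n (idx n t)" for k
    proof (rule ccontr)
      assume "\<not> ?thesis"
      then have "\<And>n. k \<le> n \<Longrightarrow> \<not> corner n (idx n t)" by blast
      then have "x $ 2 = real (ynum corner k (idx k t)) / 4 ^ k"
        unfolding t(3) by (intro straight_on_horizontal_line t(1))
      then have "x $ 2 = h (prod_encode (ynum corner k (idx k t), k))" by (simp add: h_def)
      then have "x = f (prod_encode (ynum corner k (idx k t), k)) (x $ 1)"
        unfolding f_def vec_eq_iff forall_2 by simp
      then show False using x by blast
    qed
    then show "x \<in> {x. \<exists>t. 0 \<le> t \<and> t < 1 \<and> x = point corner t \<and> (\<forall>k. \<exists>n\<ge>k. corner n (idx n t))}"
      using t by blast
  qed
  from hausdorff1_mono[OF this] have "hausdorff1 (cell corner 0 0 - (\<Union>i. range (f i))) = 0"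
    unfolding corner_infinitely_often_null by simp
  then show ?thesis unfolding countably_rectifiable1_def using lip by blast
qed

section \<open>Corner squares have large Jones numbers\<close>

lemma hyperplane_infdist:
  fixes L :: "'a::euclidean_space set"
  assumes "L \<noteq> {}" "L \<subseteq> {x. a \<bullet> x = b}" "a \<noteq> 0"
  shows "\<bar>a \<bullet> z - b\<bar> \<le> norm a * infdist z L"
proof -
  have "\<bar>a \<bullet> z - b\<bar> / norm a \<le> (INF y\<in>L. dist z y)"
  proof (rule cINF_greatest)
    fix y assume "y \<in> L"
    then have "\<bar>a \<bullet> z - b\<bar> = \<bar>a \<bullet> (z - y)\<bar>" using assms(2) by (auto simp: inner_diff_right)
    also have "\<dots> \<le> norm a * dist z y" unfolding dist_norm by (rule Cauchy_Schwarz_ineq2)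
    finally show "\<bar>a \<bullet> z - b\<bar> / norm a \<le> dist z y" using assms(3) by (simp add: field_simps)
  qed (fact assms(1))
  then show ?thesis using assms(1,3) by (simp add: infdist_notempty field_simps)
qed

text \<open>
  Suppose a line with normal \<open>a\<close> comes within a sixteenth of the side of points in the lower left,
  lower right and upper left corner squares. The affine function \<open>z \<mapsto> a \<bullet> z - b\<close> then varies little
  between them. In units of the side, the first two are at least \<open>1/2\<close> apart horizontally and at most
  \<open>1/4\<close> vertically, which forces \<open>\<bar>a $ 1\<bar> < \<bar>a $ 2\<bar>\<close>. The first and third force the reverse
  inequality.
\<close>

lemma line_avoids_corner:
  assumes L: "L \<in> affine_lines" and C: "C n m"
  shows "\<exists>d<4. \<forall>z\<in>square C (Suc n) (4 * m + d). 1 / (16 * 4 ^ n) \<le> infdist z L"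
proof (rule ccontr)
  assume far: "\<not> ?thesis"
  have near: "\<exists>z\<in>square C (Suc n) (4 * m + d). infdist z L < 1 / (16 * 4 ^ n)" if "d < 4" for d
    using far that by (meson not_le)
  obtain z0 where z0: "z0 \<in> square C (Suc n) (4 * m)" "infdist z0 L < 1 / (16 * 4 ^ n)"
    using near[of 0] by auto
  obtain z1 where z1: "z1 \<in> square C (Suc n) (4 * m + 1)" "infdist z1 L < 1 / (16 * 4 ^ n)"
    using near[of 1] by auto
  obtain z2 where z2: "z2 \<in> square C (Suc n) (4 * m + 2)" "infdist z2 L < 1 / (16 * 4 ^ n)"
    using near[of 2] by auto
  have ne: "L \<noteq> {}" and "aff_dim L < DIM(real^2)" using L by (auto simp: affine_lines_def)
  then obtain a b where ab: "a \<noteq> 0" "L \<subseteq> {x. a \<bullet> x = b}"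
    using aff_lowdim_subset_hyperplane[of L] by metis
  define A where "A = \<bar>a $ 1\<bar> + \<bar>a $ 2\<bar>"
  have "norm a \<le> A" using norm_le_l1_cart[of a] by (simp add: A_def sum_2)
  moreover have "0 < norm a" using ab(1) by simp
  ultimately have A: "0 < A" by linarith
  define u where "u z = 4 ^ n * (a \<bullet> z - b)" for z
  have small: "\<bar>u z\<bar> < A / 16" if "infdist z L < 1 / (16 * 4 ^ n)" for z
  proof -
    have "\<bar>a \<bullet> z - b\<bar> \<le> norm a * infdist z L" by (rule hyperplane_infdist[OF ne ab(2,1)])
    also have "\<dots> < norm a * (1 / (16 * 4 ^ n))" using that \<open>0 < norm a\<close> by (rule mult_strict_left_mono)
    also have "\<dots> \<le> A * (1 / (16 * 4 ^ n))" using \<open>norm a \<le> A\<close> by (intro mult_right_mono) auto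
    finally have "4 ^ n * \<bar>a \<bullet> z - b\<bar> < 4 ^ n * (A * (1 / (16 * 4 ^ n)))"
      by (rule mult_strict_left_mono) simp
    also have "\<dots> = A / 16" by simp
    finally show ?thesis by (simp add: u_def abs_mult)
  qed
  define X Y where "X z = 4 ^ n * (z $ 1 :: real)" and "Y z = 4 ^ n * (z $ 2 :: real)" for z :: "real^2"
  have diff: "u z - u w = a $ 1 * (X z - X w) + a $ 2 * (Y z - Y w)" for z w
    by (simp add: u_def X_def Y_def inner_vec_def sum_2 algebra_simps)
  have sq: "z \<in> square C (Suc n) p \<longleftrightarrow>
      real (xnum C (Suc n) p) \<le> 4 * X z \<and> 4 * X z \<le> real (xnum C (Suc n) p) + 1 \<and>
      real (ynum C (Suc n) p) \<le> 4 * Y z \<and> 4 * Y z \<le> real (ynum C (Suc n) p) + 1" for z p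
    by (simp add: square_def X_def Y_def mult.assoc del: xnum.simps ynum.simps)
  have div: "4 * m div 4 = m" "(4 * m + 1) div 4 = m" "(4 * m + 2) div 4 = m" by simp_all
  have mods: "4 * m mod 2 = 0" "(4 * m + 1) mod 2 = 1" "(4 * m + 2) mod 2 = 0"
    "4 * m mod 4 div 2 = 0" "(4 * m + 1) mod 4 div 2 = 0" "(4 * m + 2) mod 4 div 2 = 1"
    by presburger+
  let ?x = "real (xnum C n m)" and ?y = "real (ynum C n m)"
  have b0: "4 * ?x \<le> 4 * X z0" "4 * X z0 \<le> 4 * ?x + 1" "4 * ?y \<le> 4 * Y z0" "4 * Y z0 \<le> 4 * ?y + 1"
    using z0(1) unfolding sq xnum.simps ynum.simps div if_P[OF C] mods by simp_all
  have b1: "4 * ?x + 3 \<le> 4 * X z1" "4 * X z1 \<le> 4 * ?x + 4" "4 * ?y \<le> 4 * Y z1" "4 * Y z1 \<le> 4 * ?y + 1"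
    using z1(1) unfolding sq xnum.simps ynum.simps div if_P[OF C] mods by simp_all
  have b2: "4 * ?x \<le> 4 * X z2" "4 * X z2 \<le> 4 * ?x + 1" "4 * ?y + 3 \<le> 4 * Y z2" "4 * Y z2 \<le> 4 * ?y + 4"
    using z2(1) unfolding sq xnum.simps ynum.simps div if_P[OF C] mods by simp_all
  have dist: "1 / 2 \<le> \<bar>X z1 - X z0\<bar>" "\<bar>Y z1 - Y z0\<bar> \<le> 1 / 4"
    "1 / 2 \<le> \<bar>Y z2 - Y z0\<bar>" "\<bar>X z2 - X z0\<bar> \<le> 1 / 4"
    using b0 b1 b2 by linarith+
  have "\<bar>a $ 1\<bar> * (1 / 2) \<le> \<bar>a $ 1 * (X z1 - X z0)\<bar>"
    unfolding abs_mult by (intro mult_left_mono dist) simp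
  moreover have "\<bar>a $ 2 * (Y z1 - Y z0)\<bar> \<le> \<bar>a $ 2\<bar> * (1 / 4)"
    unfolding abs_mult by (intro mult_left_mono dist) simp
  moreover have "\<bar>u z1 - u z0\<bar> < A / 8" using small[OF z0(2)] small[OF z1(2)] by linarith
  ultimately have 1: "\<bar>a $ 1\<bar> * (1 / 2) < A / 8 + \<bar>a $ 2\<bar> * (1 / 4)" using diff[of z1 z0] by linarith
  have "\<bar>a $ 2\<bar> * (1 / 2) \<le> \<bar>a $ 2 * (Y z2 - Y z0)\<bar>"
    unfolding abs_mult by (intro mult_left_mono dist) simp
  moreover have "\<bar>a $ 1 * (X z2 - X z0)\<bar> \<le> \<bar>a $ 1\<bar> * (1 / 4)"
    unfolding abs_mult by (intro mult_left_mono dist) simp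
  moreover have "\<bar>u z2 - u z0\<bar> < A / 8" using small[OF z0(2)] small[OF z2(2)] by linarith
  ultimately have 2: "\<bar>a $ 2\<bar> * (1 / 2) < A / 8 + \<bar>a $ 1\<bar> * (1 / 4)" using diff[of z2 z0] by linarith
  show False using add_strict_mono[OF 1 2] A_def by (simp add: field_simps)
qed

lemma esqrt_square: "(esqrt x)\<^sup>2 = x"
proof (cases "x = \<infinity>")
  case False
  then have "(esqrt x)\<^sup>2 = ennreal ((sqrt (enn2real x))\<^sup>2)" by (simp add: esqrt_def ennreal_power)
  also have "\<dots> = x" using False by (simp add: less_top)
  finally show ?thesis .
qed (simp add: esqrt_def power2_eq_square)

text \<open>
  For \<open>2 / 4 ^ n < r \<le> 8 / 4 ^ n\<close> and points \<open>1 / (16 * 4 ^ n)\<close> away from the line, the factors bound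
  from below the square of \<open>dist / r\<close>, then \<open>1 / (4 ^ n * r)\<close>, then \<open>4 ^ n\<close> times the measure of a cell of
  level \<open>n + 1\<close>.
\<close>

definition kappa :: real where "kappa = (1 / 128)\<^sup>2 * (1 / 8) * (1 / (196 * 4))"

text \<open>
  The centre \<open>y\<close> is only required to lie in the square, not in the set: the estimate is later
  integrated over a Borel set containing a cell.
\<close>

lemma jones_beta_ge:
  assumes C: "C n m" and m: "m < 4 ^ n" and y: "y \<in> square C n m"
    and r: "2 / 4 ^ n < r" "r \<le> 8 / 4 ^ n"
  shows "ennreal kappa \<le> (jones_beta (cell C 0 0) y r)\<^sup>2"
  unfolding jones_beta_def esqrt_square
proof (rule INF_greatest)
  fix L assume L: "L \<in> affine_lines"
  let ?E = "cell C 0 0"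
  have r0: "0 < r" using r(1) by (rule order.strict_trans[rotated]) simp
  \<comment> \<open>The corner subsquare far from the line carries enough measure on its own.\<close>
  obtain d where d: "d < 4" "\<And>z. z \<in> square C (Suc n) (4 * m + d) \<Longrightarrow> 1 / (16 * 4 ^ n) \<le> infdist z L"
    using line_avoids_corner[of L C n m, OF L C] by blast
  let ?q = "4 * m + d"
  have q: "?q < 4 ^ Suc n" "?q div 4 = m" using m d(1) by auto
  let ?S = "square C (Suc n) ?q"
  have S: "?S \<in> sets borel" by (simp add: closed_square borel_closed)
  have "?S \<subseteq> square C n m" using square_Suc_subset[of C n ?q] q(2) by simp
  then have ball: "?S \<subseteq> ball y r" using square_dist[OF y] r(1) by (fastforce simp: subset_iff)
  have "kappa = ((1 / 128)\<^sup>2 * (4 ^ n / 8)) * (1 / (196 * 4 ^ Suc n))"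
    by (simp add: kappa_def power2_eq_square)
  then have "ennreal kappa = ennreal ((1 / 128)\<^sup>2 * (4 ^ n / 8)) * ennreal (1 / (196 * 4 ^ Suc n))"
    by (metis ennreal_mult'' zero_le_divide_1_iff zero_le_mult_iff zero_le_numeral zero_le_power)
  also have "\<dots> \<le> ennreal ((1 / 128)\<^sup>2 * (4 ^ n / 8)) * emeasure (hausdorff1_restr ?E) ?S"
  proof (rule mult_left_mono)
    have "ennreal (1 / (196 * 4 ^ Suc n)) \<le> hausdorff1 (cell C (Suc n) ?q)"
      using q(1) by (rule hausdorff1_cell_ge)
    also have "\<dots> \<le> hausdorff1 (?E \<inter> ?S)"
      using cell_subset_root[OF q(1), of C] cell_subset_square[of C "Suc n" ?q]
      by (intro hausdorff1_mono) blast
    finally show "ennreal (1 / (196 * 4 ^ Suc n)) \<le> emeasure (hausdorff1_restr ?E) ?S"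
      using S by (simp add: emeasure_hausdorff1_restr)
  qed simp
  also have "\<dots> = (\<integral>\<^sup>+z. ennreal ((1 / 128)\<^sup>2 * (4 ^ n / 8)) * indicator ?S z \<partial>hausdorff1_restr ?E)"
    using S by (subst nn_integral_cmult_indicator) auto
  also have "\<dots> \<le> (\<integral>\<^sup>+z\<in>ball y r. ennreal ((infdist z L / r)\<^sup>2 / r) \<partial>hausdorff1_restr ?E)"
  proof (rule nn_integral_mono)
    fix z
    show "ennreal ((1 / 128)\<^sup>2 * (4 ^ n / 8)) * indicator ?S z \<le>
        ennreal ((infdist z L / r)\<^sup>2 / r) * indicator (ball y r) z"
    proof (cases "z \<in> ?S")
      case True
      have "1 / 128 = 1 / (16 * 4 ^ n) / (8 / 4 ^ n :: real)" by simp
      also have "\<dots> \<le> infdist z L / r" using d(2)[OF True] r r0 by (intro frac_le) auto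
      finally have "(1 / 128)\<^sup>2 \<le> (infdist z L / r)\<^sup>2" by (rule power_mono) simp
      moreover have "4 ^ n / 8 \<le> 1 / r" using r(2) r0 by (simp add: field_simps)
      ultimately have "(1 / 128)\<^sup>2 * (4 ^ n / 8) \<le> (infdist z L / r)\<^sup>2 * (1 / r)"
        by (intro mult_mono) auto
      then have "ennreal ((1 / 128)\<^sup>2 * (4 ^ n / 8)) \<le> ennreal ((infdist z L / r)\<^sup>2 / r)"
        by (intro ennreal_leI) simp
      then show ?thesis using True ball by (simp add: subset_iff)
    qed simp
  qed
  finally show "ennreal kappa \<le> (\<integral>\<^sup>+z\<in>ball y r. ennreal ((infdist z L / r)\<^sup>2 / r) \<partial>hausdorff1_restr ?E)" .
qed

section \<open>Divergence\<close>

lemma nn_integral_scales_ge: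
  assumes a: "0 < a" "a \<le> b" "b < \<delta>" and "0 \<le> c"
    and F: "\<And>r. a < r \<Longrightarrow> r \<le> b \<Longrightarrow> ennreal c \<le> F r"
  shows "ennreal (c * ln (b / a)) \<le> (\<integral>\<^sup>+r\<in>{0<..<\<delta>}. F r * ennreal (1 / r) \<partial>lborel)"
proof -
  have "(\<integral>\<^sup>+r. ennreal (1 / r) * indicator {a..b} r \<partial>lborel) = ln b - ln a"
  proof (rule nn_integral_FTC_Icc)
    fix x assume "x \<in> {a..b}"
    then have "0 < x" using a(1) by simp
    then show "(ln has_real_derivative 1 / x) (at x)" "0 \<le> 1 / x" 
      by (auto intro!: derivative_eq_intros)
  qed (use a in auto)
  then have "ennreal (c * ln (b / a)) = (\<integral>\<^sup>+r. ennreal c * (ennreal (1 / r) * indicator {a..b} r) \<partial>lborel)"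
    using a \<open>0 \<le> c\<close> by (simp add: nn_integral_cmult ln_div ennreal_mult)
  also have "\<dots> \<le> (\<integral>\<^sup>+r\<in>{0<..<\<delta>}. F r * ennreal (1 / r) \<partial>lborel)"
  \<comment> \<open>Almost everywhere, since the lower bound on \<open>F\<close> leaves out the endpoint \<open>a\<close>.\<close>
  proof (rule nn_integral_mono_AE)
    show "AE r in lborel. ennreal c * (ennreal (1 / r) * indicator {a..b} r) \<le>
        F r * ennreal (1 / r) * indicator {0<..<\<delta>} r"
      using AE_lborel_singleton[of a]
    proof eventually_elim
      case (elim r)
      show ?case
      proof (cases "r \<in> {a..b}")
        case True
        then show ?thesis using elim a F[of r] by (auto intro: mult_right_mono)
      qed simp
    qed
  qed
  finally show ?thesis .
qed

text \<open>
  The square of level \<open>k\<close> containing \<open>x\<close> lies in the ball. Its descendant \<open>p\<close> of level \<open>2 * k\<close> obtained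
  by appending \<open>k\<close> zeros triggers \<open>64 ^ k\<close> levels of corner splits. Integrating \<open>dr / r\<close> over the
  matching radii gives \<open>64 ^ k * ln 4\<close>, which is multiplied by the measure of the cell \<open>p\<close>.
\<close>

lemma jones_integral_ge:
  assumes x: "x \<in> cell corner 0 0" and k: "2 / 4 ^ k < \<delta>"
  shows "ennreal (kappa / 196 * 4 ^ k) \<le>
    (\<integral>\<^sup>+y\<in>ball x \<delta>. (\<integral>\<^sup>+r\<in>{0<..<\<delta>}. (jones_beta (cell corner 0 0) y r)\<^sup>2 * ennreal (1 / r) \<partial>lborel)
       \<partial>hausdorff1_restr (cell corner 0 0))"
proof -
  let ?E = "cell corner 0 0"
  let ?J = "\<lambda>y. \<integral>\<^sup>+r\<in>{0<..<\<delta>}. (jones_beta ?E y r)\<^sup>2 * ennreal (1 / r) \<partial>lborel"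
  obtain t where t: "0 \<le> t" "t < 1" "x = point corner t" using x by (rule root_cell_cases)
  define p where "p = idx k t * 4 ^ k"
  define N :: nat where "N = 64 ^ k"
  define M where "M = 2 * k + N"
  have p: "p < 4 ^ (2 * k)" "p div 4 ^ k = idx k t"
    using idx_less[OF t(1,2), of k] by (simp_all add: p_def mult_2 power_add)
  \<comment> \<open>The finite union \<open>B\<close> of the closed squares at the last level is a Borel set containing the cell
    \<open>p\<close>, and each of its points has all the intermediate squares around it.\<close>
  define Q where "Q = {q. q < 4 ^ M \<and> q div 4 ^ N = p}"
  define B where "B = (\<Union>q\<in>Q. square corner M q)"
  have "finite Q" by (rule finite_subset[of _ "{..<4 ^ M}"]) (auto simp: Q_def)
  then have B: "B \<in> sets borel"
    unfolding B_def by (intro sets.finite_UN borel_closed closed_square)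
  have B_ball: "B \<subseteq> ball x \<delta>"
  proof
    fix y assume "y \<in> B"
    then obtain q where "q div 4 ^ N = p" "y \<in> square corner M q" unfolding B_def Q_def by blast
    then have "y \<in> square corner (k + k) p"
      using square_subset_ancestor[of corner "2 * k" N q] unfolding M_def mult_2 by blast
    then have "y \<in> square corner k (idx k t)"
      using square_subset_ancestor[of corner k k p] unfolding p(2) by blast
    then have "dist x y \<le> 2 / 4 ^ k" using square_dist point_in_square[OF t(1)] t(3) by blast
    then show "y \<in> ball x \<delta>" using k by simp
  qed
  have cell_B: "cell corner (2 * k) p \<subseteq> ?E \<inter> B"
  proof -
    have "q < 4 ^ M" if "q div 4 ^ N = p" for q
    proof -
      have "q < Suc p * 4 ^ N" using that by (simp flip: that add: dividend_less_div_times)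
      also have "\<dots> \<le> 4 ^ (2 * k) * 4 ^ N" using p(1) by (intro mult_right_mono) auto
      finally show ?thesis by (simp add: M_def power_add)
    qed
    then have "cell corner (2 * k) p \<subseteq> B"
      using cell_descendants[of corner "2 * k" p N] cell_subset_square[of corner M]
      unfolding B_def Q_def M_def by blast
    then show ?thesis using cell_subset_root[OF p(1)] by blast
  qed
  have J: "ennreal (kappa * N) \<le> ?J y" if y: "y \<in> B" for y
  proof -
    obtain q where "q \<in> Q" "y \<in> square corner M q" using y unfolding B_def by blast
    then have q: "q < 4 ^ M" "q div 4 ^ N = p" "y \<in> square corner M q" by (auto simp: Q_def)
    let ?a = "2 / 4 ^ M :: real" and ?b = "2 / 4 ^ (2 * k) :: real"
    have "?b / ?a = 4 ^ N" by (simp add: M_def power_add)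
    then have "ln (?b / ?a) = N * ln 4" by (simp add: ln_realpow)
    moreover have "1 \<le> ln (4::real)" using exp_le by (subst ln_ge_iff) auto
    ultimately have "kappa * N \<le> kappa * ln (?b / ?a)"
      using mult_left_mono[of 1 "ln 4" "real N"] by (intro mult_left_mono) (auto simp: kappa_def)
    then have "ennreal (kappa * N) \<le> ennreal (kappa * ln (?b / ?a))" by (rule ennreal_leI)
    also have "\<dots> \<le> ?J y"
    proof (rule nn_integral_scales_ge)
      show "?a \<le> ?b" by (intro divide_left_mono power_increasing) (auto simp: M_def)
      have "?b \<le> 2 / 4 ^ k" by (intro divide_left_mono power_increasing) auto
      then show "?b < \<delta>" using k by linarith
      fix r assume r: "?a < r" "r \<le> ?b"
      have "0 < ?a" by simp
      then have r0: "0 < r" using r(1) by linarith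
      have "?b \<le> 2 / 4 ^ 0" by (intro divide_left_mono power_increasing) auto
      then have "r \<le> 2" using r(2) by simp
      then obtain i where i: "2 / 4 ^ Suc i < r" "r \<le> 2 / 4 ^ i" using exists_scale[OF r0] by blast
      \<comment> \<open>At this level the square around \<open>y\<close> fits into the ball of radius \<open>r\<close> and is comparable to it.\<close>
      let ?n = "Suc i"
      have "2 / 4 ^ ?n < (2 / 4 ^ (2 * k) :: real)" using i(1) r(2) by linarith
      then have "(4::real) ^ (2 * k) < 4 ^ ?n" by (simp add: field_simps)
      then have nk: "2 * k < ?n" by (subst (asm) power_strict_increasing_iff) auto
      have "2 / 4 ^ M < (2 / 4 ^ i :: real)" using i(2) r(1) by linarith
      then have "(4::real) ^ i < 4 ^ M" by (simp add: field_simps)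
      then have nM: "?n \<le> M" by (subst (asm) power_strict_increasing_iff) auto
      let ?m = "q div 4 ^ (M - ?n)"
      have "?m < 4 ^ ?n" using q(1) nM by (simp add: div_less_iff_less_mult flip: power_add del: power_Suc)
      moreover have "y \<in> square corner ?n ?m"
        using q(3) nM square_subset_ancestor[of corner ?n "M - ?n" q] by auto
      moreover have "corner ?n ?m"
        unfolding corner_def
      proof (intro exI conjI)
        show "2 * k \<le> ?n" "?n \<le> 2 * k + 64 ^ k" using nk nM by (simp_all add: M_def N_def)
        have "?m div 4 ^ (?n - 2 * k) = q div 4 ^ ((M - ?n) + (?n - 2 * k))"
          by (simp add: power_add div_mult2_eq del: power_Suc)
        also have "(M - ?n) + (?n - 2 * k) = N" using nk nM by (simp add: M_def)
        finally show "4 ^ k dvd ?m div 4 ^ (?n - 2 * k)" using q(2) by (simp add: p_def)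
      qed
      ultimately show "ennreal kappa \<le> (jones_beta ?E y r)\<^sup>2"
        using i by (intro jones_beta_ge) auto
    qed (simp_all add: kappa_def)
    finally show ?thesis .
  qed
  have "real N = 4 ^ k * 4 ^ (2 * k)"
    by (simp add: N_def mult_2 power_add flip: power_mult_distrib)
  then have "kappa / 196 * 4 ^ k = kappa * N * (1 / (196 * 4 ^ (2 * k)))" by simp
  then have "ennreal (kappa / 196 * 4 ^ k) = ennreal (kappa * N) * ennreal (1 / (196 * 4 ^ (2 * k)))"
    by (simp add: kappa_def flip: ennreal_mult)
  also have "\<dots> \<le> ennreal (kappa * N) * emeasure (hausdorff1_restr ?E) B"
    using hausdorff1_cell_ge[OF p(1), of corner] hausdorff1_mono[OF cell_B]
    unfolding emeasure_hausdorff1_restr[OF B] by (intro mult_left_mono) (auto intro: order_trans)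
  also have "\<dots> = (\<integral>\<^sup>+y. ennreal (kappa * N) * indicator B y \<partial>hausdorff1_restr ?E)"
    using B by (subst nn_integral_cmult_indicator) auto
  also have "\<dots> \<le> (\<integral>\<^sup>+y\<in>ball x \<delta>. ?J y \<partial>hausdorff1_restr ?E)"
    using J B_ball by (intro nn_integral_mono) (auto simp: indicator_def)
  finally show ?thesis .
qed

theorem theorem1p2:
  shows "\<exists>A\<^sub>0 :: (real^2) set.
    A\<^sub>0 \<noteq> {} \<and> A\<^sub>0 \<subseteq> cbox 0 1 \<and> ahlfors_regular1 A\<^sub>0 \<and> countably_rectifiable1 A\<^sub>0 \<and>
    (\<forall>x\<in>A\<^sub>0. \<forall>\<delta>>0.
      (\<integral>\<^sup>+y\<in>ball x \<delta>. (\<integral>\<^sup>+r\<in>{0<..<\<delta>}. (jones_beta A\<^sub>0 y r)\<^sup>2 * ennreal (1 / r) \<partial>lborel)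
         \<partial>hausdorff1_restr A\<^sub>0) = \<infinity>)"
proof (intro exI[of _ "cell corner 0 0"] conjI ballI allI impI)
  have "point corner 0 \<in> cell corner 0 0" unfolding cell_def idx_def by auto
  then show "cell corner 0 0 \<noteq> {}" by blast
  show "cell corner 0 0 \<subseteq> cbox 0 1"
    using cell_subset_square[of corner 0 0] by (auto simp: square_def mem_box_cart forall_2)
  show "ahlfors_regular1 (cell corner 0 0)" by (rule ahlfors_regular1_root)
  show "countably_rectifiable1 (cell corner 0 0)" by (rule countably_rectifiable1_root)
  fix x :: "real^2" and \<delta> :: real
  assume x: "x \<in> cell corner 0 0" and "0 < \<delta>"
  let ?I = "\<integral>\<^sup>+y\<in>ball x \<delta>. (\<integral>\<^sup>+r\<in>{0<..<\<delta>}. (jones_beta (cell corner 0 0) y r)\<^sup>2 * ennreal (1 / r) \<partial>lborel)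
      \<partial>hausdorff1_restr (cell corner 0 0)"
  have "ennreal v \<le> ?I" for v
  proof -
    obtain k where k: "max (2 / \<delta>) (v / (kappa / 196)) < 4 ^ k"
      using real_arch_pow[of 4 "max (2 / \<delta>) (v / (kappa / 196))"] by auto
    have "0 < kappa" by (simp add: kappa_def)
    have "2 / 4 ^ k < \<delta>" using k \<open>0 < \<delta>\<close> by (simp add: field_simps)
    then have "ennreal (kappa / 196 * 4 ^ k) \<le> ?I" by (rule jones_integral_ge[OF x])
    moreover have "v \<le> kappa / 196 * 4 ^ k" using k \<open>0 < kappa\<close> by (simp add: field_simps)
    ultimately show ?thesis using ennreal_leI order_trans by blast
  qed
  from this[of "enn2real ?I + 1"] show "?I = \<infinity>"
    by (cases ?I) (auto simp: ennreal_le_iff)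
qed

end
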